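(* Let $T=T(r,s,t)$. If the triangulation $T$ of the torus admits a $3$-coloring, then every $4$-coloring of $T$ whose degree is divisible by $12$ is Kempe equivalent (as a $4$-coloring) to the $3$-coloring of $T$.
   Context: The triangulation $T(r,s,t)$ of the torus is obtained from the grid with $r$ edges horizontally and $s$ edges vertically by adding in each unit square the diagonal from its lower-left to its upper-right corner, identifying the left and right sides as usual, and identifying the top and bottom rows after cyclically shifting the top row by $t$ edges to the right. Explicitly: vertices are the classes of $\mathbb{Z}^2$ modulo the lattice generated by $(r,0)$ and $(-t,s)$; edges are the images of the segments from $(x,y)$ to $(x+1,y)$, $(x,y+1)$, $(x+1,y+1)$; triangles are the images of $\{(x,y),(x+1,y),(x+1,y+1)\}$ and $\{(x,y),(x,y+1),(x+1,y+1)\}$. All vertices have degree $6$. A $q$-coloring is a proper vertex coloring with colors $\{1,\dots,q\}$. Colorings differing by a global permutation of colors are identified; the $3$-coloring of $T(r,s,t)$, if it exists, is unique in this sense, and is regarded as a $4$-coloring not using one of the colors. Degree of a $4$-coloring $f$: regard $f$ as a non-degenerate simplicial map to the boundary $\partial\Delta^3$ of the tetrahedron with vertices $1,2,3,4$; fix orientations of the torus and of $\partial\Delta^3$. For a triangle $\tau$ of $\partial\Delta^3$ let $p$ (resp. $n$) be the number of triangles of $T$ mapped onto $\tau$ with orientation preserved (resp. reversed). Then $\deg(f)=p-n$, independent of $\tau$ and, up to sign, of the orientations. A Kempe change (K-change) interchanges two colors $a,b$ on one connected component of the subgraph induced by the vertices colored $a$ or $b$. Two $4$-colorings are Kempe equivalent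 if one can be obtained from the other by a finite sequence of K-changes using the four colors. *)

theory Defs
  imports Main "HOL-Library.FuncSet" "HOL-Combinatorics.Transposition"
begin

section \<open>Colorings and Kempe changes\<close>

text \<open>
  A graph is a vertex set \<open>V\<close> with a set \<open>E\<close> of unordered pairs; a loop at \<open>u\<close> is the singleton
  \<open>{u} = {u, u}\<close>, so a graph with a loop has no proper coloring.  Colorings are extensional
  (undefined outside \<open>V\<close>), so that equal colorings are equal as HOL functions.
\<close>

definition proper_coloring :: "'v set \<Rightarrow> 'v set set \<Rightarrow> nat \<Rightarrow> ('v \<Rightarrow> nat) \<Rightarrow> bool" where
  "proper_coloring V E q f \<longleftrightarrow>
     f \<in> V \<rightarrow>\<^sub>E {1..q} \<and> (\<forall>u v. {u, v} \<in> E \<longrightarrow> f u \<noteq> f v)"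

definition kempe_component ::
  "'v set \<Rightarrow> 'v set set \<Rightarrow> ('v \<Rightarrow> nat) \<Rightarrow> nat \<Rightarrow> nat \<Rightarrow> 'v \<Rightarrow> 'v set" where
  "kempe_component V E f a b w =
     {(u, v). u \<in> V \<and> v \<in> V \<and> f u \<in> {a, b} \<and> f v \<in> {a, b} \<and> {u, v} \<in> E}\<^sup>* `` {w}"

definition kempe_change ::
  "'v set \<Rightarrow> 'v set set \<Rightarrow> nat \<Rightarrow> ('v \<Rightarrow> nat) \<Rightarrow> ('v \<Rightarrow> nat) \<Rightarrow> bool" where
  "kempe_change V E q f g \<longleftrightarrow>
     (\<exists>a \<in> {1..q}. \<exists>b \<in> {1..q}. \<exists>w \<in> V. a \<noteq> b \<and> f w \<in> {a, b} \<and>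
        g = (\<lambda>v. if v \<in> kempe_component V E f a b w then transpose a b (f v) else f v))"

definition kempe_equivalent ::
  "'v set \<Rightarrow> 'v set set \<Rightarrow> nat \<Rightarrow> ('v \<Rightarrow> nat) \<Rightarrow> ('v \<Rightarrow> nat) \<Rightarrow> bool" where
  "kempe_equivalent V E q = (kempe_change V E q)\<^sup>*\<^sup>*"

section \<open>The triangulation \<open>T(r, s, t)\<close> of the torus\<close>

definition torus_rel :: "int \<Rightarrow> int \<Rightarrow> int \<Rightarrow> ((int \<times> int) \<times> (int \<times> int)) set" where
  "torus_rel r s t =
     {((x, y), (x', y')). \<exists>m n. x' = x + m * r - n * t \<and> y' = y + n * s}"

definition torus_point :: "int \<Rightarrow> int \<Rightarrow> int \<Rightarrow> int \<Rightarrow> int \<Rightarrow> (int \<times> int) set" where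
  "torus_point r s t x y = torus_rel r s t `` {(x, y)}"

definition torus_vertices :: "int \<Rightarrow> int \<Rightarrow> int \<Rightarrow> (int \<times> int) set set" where
  "torus_vertices r s t = UNIV // torus_rel r s t"

definition torus_edges :: "int \<Rightarrow> int \<Rightarrow> int \<Rightarrow> (int \<times> int) set set set" where
  "torus_edges r s t =
     {{torus_point r s t x y, torus_point r s t (x + i) (y + j)} | x y i j.
        (i, j) \<in> {(1, 0), (0, 1), (1, 1)}}"

text \<open>
  A triangle is recorded as the triple of its corners, listed counterclockwise in the plane from
  the lower-left corner.  This fixes the orientation of the torus, and it keeps triangles with
  different lower-left corners apart even if \<open>r\<close> and \<open>s\<close> are so small that several
  triangles have the same set of corners.
\<close>

definition torus_triangles ::
  "int \<Rightarrow> int \<Rightarrow> int \<Rightarrow> ((int \<times> int) set \<times> (int \<times> int) set \<times> (int \<times> int) set) set" where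
  "torus_triangles r s t =
     {(torus_point r s t x y, torus_point r s t (x + 1) y, torus_point r s t (x + 1) (y + 1))
        | x y. True} \<union>
     {(torus_point r s t x y, torus_point r s t (x + 1) (y + 1), torus_point r s t x (y + 1))
        | x y. True}"

section \<open>Degree of a 4-coloring\<close>

text \<open>
  The number of triangles mapped onto the face \<open>{a, b, c}\<close> of the tetrahedron such that their
  counterclockwise orientation is carried to the cyclic orientation \<open>a \<rightarrow> b \<rightarrow> c \<rightarrow> a\<close>.
\<close>

definition face_count :: "int \<Rightarrow> int \<Rightarrow> int \<Rightarrow> ((int \<times> int) set \<Rightarrow> nat) \<Rightarrow> nat \<Rightarrow> nat \<Rightarrow> nat \<Rightarrow> nat" where
  "face_count r s t f a b c =
     card {(u, v, w) \<in> torus_triangles r s t.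
             (f u, f v, f w) \<in> {(a, b, c), (b, c, a), (c, a, b)}}"

text \<open>
  The count of preserved minus reversed triangles is the same for every face of the coherently
  oriented tetrahedron, and changes sign with the orientation; we use the face \<open>{1, 2, 3}\<close>,
  oriented as \<open>1 \<rightarrow> 2 \<rightarrow> 3 \<rightarrow> 1\<close>.
\<close>

definition coloring_degree :: "int \<Rightarrow> int \<Rightarrow> int \<Rightarrow> ((int \<times> int) set \<Rightarrow> nat) \<Rightarrow> int" where
  "coloring_degree r s t f = int (face_count r s t f 1 2 3) - int (face_count r s t f 1 3 2)"

end

theory Submission imports Defs begin

text \<open>
  Lift a 4-coloring to the plane. Reading the four colors as the classes of the triangular lattice
  \<open>A\<close> modulo \<open>2A\<close>, it lifts to a height function \<open>h\<close> from the plane triangulation to \<open>A\<close>, which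
  shifts by a homomorphism \<open>\<phi>\<close> from the period lattice to \<open>2A\<close>. The degree is half the
  determinant of \<open>\<phi>\<close>, and 3-colorability of \<open>T\<close> puts the image of \<open>\<phi>\<close> into a sublattice of
  index 12.

  Let \<open>n\<close> be one of the three linear functionals on \<open>A\<close> that are constant along an edge direction.
  Two adjacent vertices whose values of \<open>n \<circ> h\<close> have the same parity lie on the same level, so folding
  the target along level lines of \<open>n\<close> amounts to Kempe changes. If 12 divides the degree, then some
  \<open>n \<circ> \<phi>\<close> takes values in \<open>4\<int>\<close>, and folding with period 4 makes it vanish. Then \<open>\<phi>\<close> has rank at
  most 1, and a fold of period 6 along another functional, followed by another fold of period 4,
  makes \<open>\<phi>\<close> vanish. Now \<open>h\<close> is bounded and can be folded further, into a single triangle, that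
  is, into a 3-coloring.
\<close>

section \<open>Swapping two colors on a union of Kempe components\<close>

text \<open>The last hypothesis makes \<open>S\<close>, restricted to the colors \<open>a\<close>
  and \<open>b\<close>, a union of Kempe components. They are swapped one at a time, by induction on
  \<open>card S\<close>.\<close>

lemma kempe_equivalent_swap:
  assumes "finite V" "S \<subseteq> V" "a \<in> {1..q}" "b \<in> {1..q}" "a \<noteq> b"
    and "\<And>u v. u \<in> S \<Longrightarrow> v \<in> V \<Longrightarrow> f u \<in> {a, b} \<Longrightarrow> f v \<in> {a, b} \<Longrightarrow> {u, v} \<in> E \<Longrightarrow> v \<in> S"
  shows "kempe_equivalent V E q f (\<lambda>v. if v \<in> S then transpose a b (f v) else f v)"
  using assms(2,6)
proof (induction "card S" arbitrary: S f rule: less_induct)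
  case less
  show ?case
  proof (cases "\<exists>w\<in>S. f w \<in> {a, b}")
    case False
    then have "(\<lambda>v. if v \<in> S then transpose a b (f v) else f v) = f"
      by (auto simp: fun_eq_iff transpose_def)
    then show ?thesis by (simp add: kempe_equivalent_def)
  next
    case True
    then obtain w where w: "w \<in> S" "f w \<in> {a, b}" by blast
    define R where "R = {(u, v). u \<in> V \<and> v \<in> V \<and> f u \<in> {a, b} \<and> f v \<in> {a, b} \<and> {u, v} \<in> E}"
    define K where "K = kempe_component V E f a b w"
    have K_alt: "K = R\<^sup>* `` {w}" by (simp add: K_def R_def kempe_component_def)
    have "sym R" by (auto simp: R_def sym_def insert_commute)
    have "v \<in> S \<and> f v \<in> {a, b}" if "(w, v) \<in> R\<^sup>*" for v
      using that
    proof (induction rule: rtrancl_induct)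
      case base then show ?case using w by simp
    next
      case (step u v)
      then show ?case using less.prems(2)[of u v] by (auto simp: R_def)
    qed
    then have KS: "K \<subseteq> S" and Kab: "\<And>v. v \<in> K \<Longrightarrow> f v \<in> {a, b}" by (auto simp: K_alt)
    define f' where "f' = (\<lambda>v. if v \<in> K then transpose a b (f v) else f v)"
    \<comment> \<open>Swapping one component keeps the set of vertices colored \<open>a\<close> or
      \<open>b\<close>, so \<open>S - K\<close> is still closed with respect to
      \<open>f'\<close>.\<close>
    have f'_iff: "f' v \<in> {a, b} \<longleftrightarrow> f v \<in> {a, b}" for v
      by (auto simp: f'_def transpose_def)
    have change: "kempe_change V E q f f'"
      unfolding kempe_change_def f'_def K_def using assms w less.prems(1) by blast
    have "w \<in> K" by (simp add: K_alt)
    then have "card (S - K) < card S"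
      using w less.prems(1) assms(1) by (intro psubset_card_mono) (auto intro: finite_subset)
    moreover have "v \<in> S - K"
      if uv: "u \<in> S - K" "v \<in> V" "f' u \<in> {a, b}" "f' v \<in> {a, b}" "{u, v} \<in> E" for u v
    proof -
      have "f u \<in> {a, b}" "f v \<in> {a, b}" using uv by (simp_all only: f'_iff)
      then have "(v, u) \<in> R"
        using uv less.prems(1) by (auto simp: R_def insert_commute)
      then have "v \<notin> K" using uv(1) by (auto simp: K_alt intro: rtrancl_into_rtrancl)
      moreover have "v \<in> S"
        using uv less.prems(2)[of u v] by (simp only: f'_iff Diff_iff)
      ultimately show ?thesis by simp
    qed
    ultimately have "kempe_equivalent V E q f'
        (\<lambda>v. if v \<in> S - K then transpose a b (f' v) else f' v)"
      using less.hyps[of "S - K" f'] less.prems(1) by blast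
    moreover have "(\<lambda>v. if v \<in> S - K then transpose a b (f' v) else f' v)
        = (\<lambda>v. if v \<in> S then transpose a b (f v) else f v)"
      using KS by (auto simp: f'_def fun_eq_iff)
    ultimately show ?thesis
      using change by (simp add: kempe_equivalent_def converse_rtranclp_into_rtranclp)
  qed
qed

section \<open>Functions on the plane\<close>

lemma int_iterate:
  fixes P :: "int \<Rightarrow> bool"
  assumes "P 0" "\<And>n. P n \<longleftrightarrow> P (n + 1)"
  shows "P n"
proof (induction n rule: int_induct[where k = 0])
  case (step2 i) then show ?case using assms(2)[of "i - 1"] by simp
qed (use assms in auto)

lemma plane_iterate:
  fixes P :: "int \<Rightarrow> int \<Rightarrow> bool"
  assumes "P 0 0" "\<And>x y. P x y \<longleftrightarrow> P (x + 1) y" "\<And>x y. P x y \<longleftrightarrow> P x (y + 1)"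
  shows "P x y"
proof (rule int_iterate[of "P x"])
  show "P x 0" by (rule int_iterate[of "\<lambda>x. P x 0"]) (use assms in auto)
qed (use assms in auto)

lemma int_antidifference:
  fixes g :: "int \<Rightarrow> int"
  obtains h where "h 0 = c" "\<And>n. h (n + 1) = h n + g n"
proof -
  \<comment> \<open>At most one of the two sums is nonempty, depending on the sign of
    \<open>n\<close>.\<close>
  let ?h = "\<lambda>n. c + (\<Sum>i\<in>{0..<n}. g i) - (\<Sum>i\<in>{n..<0}. g i)"
  have "?h (n + 1) = ?h n + g n" for n
  proof (cases "0 \<le> n")
    case True
    then have "{0..<n + 1} = insert n {0..<n}" by auto
    then show ?thesis using True by simp
  next
    case False
    then have "{n..<0} = insert n {n + 1..<0}" by auto
    then show ?thesis using False by simp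
  qed
  then show ?thesis by (intro that[of ?h]) simp_all
qed

text \<open>By hypothesis the two paths around a unit square have the same sum. The potential is
  built along the row \<open>y = 0\<close> and then up each column; the hypothesis carries the
  horizontal increments from row to row.\<close>

lemma plane_potential:
  fixes p q :: "int \<Rightarrow> int \<Rightarrow> int"
  assumes "\<And>x y. p x y + q (x + 1) y = q x y + p x (y + 1)"
  obtains h where "h 0 0 = c" "\<And>x y. h (x + 1) y = h x y + p x y"
    "\<And>x y. h x (y + 1) = h x y + q x y"
proof -
  obtain k where k: "k 0 = c" "\<And>x. k (x + 1) = k x + p x 0"
    using int_antidifference[of c "\<lambda>x. p x 0"] by blast
  have "\<forall>x. \<exists>l. l 0 = k x \<and> (\<forall>y. l (y + 1) = l y + q x y)"
    using int_antidifference by metis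
  then obtain h where h: "\<And>x. h x 0 = k x" "\<And>x y. h x (y + 1) = h x y + q x y"
    by metis
  have "h (x + 1) y = h x y + p x y" for x y
  proof (rule int_iterate[of "\<lambda>y. h (x + 1) y = h x y + p x y"])
    show "h (x + 1) 0 = h x 0 + p x 0" by (simp only: h k)
    show "(h (x + 1) n = h x n + p x n) = (h (x + 1) (n + 1) = h x (n + 1) + p x (n + 1))" for n
      using assms[of x n] by (simp only: h) linarith
  qed
  then show ?thesis using that[of h] h k by simp
qed

section \<open>Colorings of the torus as periodic functions\<close>

locale torus =
  fixes r s t :: int
  assumes r_pos: "r > 0" and s_pos: "s > 0"
begin

abbreviation "V \<equiv> torus_vertices r s t"
abbreviation "E \<equiv> torus_edges r s t"
abbreviation "pt \<equiv> torus_point r s t"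

text \<open>\<open>P\<close> and \<open>Q\<close> are the values, for one coordinate, of the period
  homomorphism on the lattice generators \<open>(r, 0)\<close> and \<open>(- t, s)\<close>.\<close>

definition quasi :: "(int \<Rightarrow> int \<Rightarrow> int) \<Rightarrow> int \<Rightarrow> int \<Rightarrow> bool" where
  "quasi h P Q \<longleftrightarrow> (\<forall>x y. h (x + r) y = h x y + P \<and> h (x - t) (y + s) = h x y + Q)"

definition periodic :: "(int \<Rightarrow> int \<Rightarrow> 'a) \<Rightarrow> bool" where
  "periodic F \<longleftrightarrow> (\<forall>x y. F (x + r) y = F x y \<and> F (x - t) (y + s) = F x y)"

text \<open>If \<open>F\<close> is periodic, the image of a class is a singleton. Restricting to
  \<open>V\<close> makes the result extensional, so that descending the lift of a coloring returns
  the same HOL function.\<close>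

definition descend :: "(int \<Rightarrow> int \<Rightarrow> 'a) \<Rightarrow> (int \<times> int) set \<Rightarrow> 'a" where
  "descend F = (\<lambda>p\<in>V. the_elem ((\<lambda>(x, y). F x y) ` p))"

definition kempe :: "(int \<Rightarrow> int \<Rightarrow> nat) \<Rightarrow> (int \<Rightarrow> int \<Rightarrow> nat) \<Rightarrow> bool" where
  "kempe F G \<longleftrightarrow> kempe_equivalent V E 4 (descend F) (descend G)"

lemma kempe_refl: "kempe F F"
  by (simp add: kempe_def kempe_equivalent_def)

lemma kempe_trans [trans]: "kempe F G \<Longrightarrow> kempe G H \<Longrightarrow> kempe F H"
  by (simp add: kempe_def kempe_equivalent_def)

section \<open>The period lattice and a fundamental domain\<close>

lemma torus_rel_iff:
  "(p, q) \<in> torus_rel r s t \<longleftrightarrow>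
     (\<exists>m n. fst q = fst p + m * r - n * t \<and> snd q = snd p + n * s)"
  by (cases p; cases q) (simp add: torus_rel_def)

lemma equiv_torus_rel: "equiv UNIV (torus_rel r s t)"
proof (rule equivI)
  show "refl (torus_rel r s t)"
    by (auto simp: refl_on_def torus_rel_iff intro!: exI[of _ 0])
  show "sym (torus_rel r s t)"
  proof (rule symI)
    fix p q assume "(p, q) \<in> torus_rel r s t"
    then obtain m n where "fst q = fst p + m * r - n * t" "snd q = snd p + n * s"
      by (auto simp: torus_rel_iff)
    then have "fst p = fst q + (- m) * r - (- n) * t" "snd p = snd q + (- n) * s" by simp_all
    then show "(q, p) \<in> torus_rel r s t" unfolding torus_rel_iff by blast
  qed
  show "trans (torus_rel r s t)"
  proof (rule transI)
    fix p q p' assume "(p, q) \<in> torus_rel r s t" "(q, p') \<in> torus_rel r s t"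
    then obtain m n m' n' where "fst q = fst p + m * r - n * t" "snd q = snd p + n * s"
      "fst p' = fst q + m' * r - n' * t" "snd p' = snd q + n' * s"
      by (auto simp: torus_rel_iff)
    then have "fst p' = fst p + (m + m') * r - (n + n') * t" "snd p' = snd p + (n + n') * s"
      by (simp_all add: algebra_simps)
    then show "(p, p') \<in> torus_rel r s t" unfolding torus_rel_iff by blast
  qed
qed simp

lemma pt_eq_iff: "pt x y = pt x' y' \<longleftrightarrow> (\<exists>m n. x' = x + m * r - n * t \<and> y' = y + n * s)"
  unfolding torus_point_def
  using eq_equiv_class_iff[OF equiv_torus_rel, of "(x, y)" "(x', y')"] by (simp add: torus_rel_iff)

lemma pt_mem: "(x, y) \<in> pt x y"
  by (auto simp: torus_point_def torus_rel_def intro!: exI[of _ 0])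

lemma vertices_eq: "V = range (\<lambda>(x, y). pt x y)"
  by (auto simp: torus_vertices_def quotient_def torus_point_def)

lemma pt_in_V [simp]: "pt x y \<in> V"
  by (auto simp: vertices_eq)

lemma pt_shift: "pt (x + r) y = pt x y" "pt (x - t) (y + s) = pt x y"
proof -
  have "pt x y = pt (x + r) y" unfolding pt_eq_iff by (intro exI[of _ 1] exI[of _ 0]) simp
  then show "pt (x + r) y = pt x y" by simp
  have "pt x y = pt (x - t) (y + s)"
    unfolding pt_eq_iff by (rule exI[of _ 0], rule exI[of _ 1]) simp
  then show "pt (x - t) (y + s) = pt x y" by simp
qed

lemma periodic_pt: "periodic (\<lambda>x y. H (pt x y))"
  by (simp add: periodic_def pt_shift)

lemma periodic_iterate:
  assumes "periodic F"
  shows "F (x + m * r - n * t) (y + n * s) = F x y"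
proof -
  have 1: "F (x + m * r) y = F x y" for x y
  proof (rule int_iterate[of "\<lambda>m. F (x + m * r) y = F x y"])
    fix m
    have "F (x + m * r + r) y = F (x + m * r) y" using assms by (simp add: periodic_def)
    then show "(F (x + m * r) y = F x y) = (F (x + (m + 1) * r) y = F x y)"
      by (simp add: algebra_simps)
  qed simp
  have "F (x + - (n * t)) (y + n * s) = F x y" for x y
  proof (rule int_iterate[of "\<lambda>n. F (x + - (n * t)) (y + n * s) = F x y"])
    fix n
    have "F (x - n * t - t) (y + n * s + s) = F (x - n * t) (y + n * s)"
      using assms by (simp add: periodic_def)
    then show "(F (x + - (n * t)) (y + n * s) = F x y) =
        (F (x + - ((n + 1) * t)) (y + (n + 1) * s) = F x y)"
      by (simp add: algebra_simps)
  qed simp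
  from this[of "x + m * r"] 1 show ?thesis by (simp add: algebra_simps)
qed

lemma fundamental_domain:
  obtains x' y' where "x' \<in> {0..<r}" "y' \<in> {0..<s}" "pt x y = pt x' y'"
proof
  \<comment> \<open>Each of the \<open>y div s\<close> vertical periods that are removed moves the
    point by \<open>t\<close> to the right.\<close>
  let ?x = "x + (y div s) * t"
  show "?x mod r \<in> {0..<r}" "y mod s \<in> {0..<s}" using r_pos s_pos by auto
  have "?x mod r = x + (- (?x div r)) * r - (- (y div s)) * t" "y mod s = y + (- (y div s)) * s"
    by (auto simp: minus_div_mult_eq_mod[symmetric])
  then show "pt x y = pt (?x mod r) (y mod s)" unfolding pt_eq_iff by blast
qed

lemma fundamental_domain_inj:
  assumes "x \<in> {0..<r}" "y \<in> {0..<s}" "x' \<in> {0..<r}" "y' \<in> {0..<s}" "pt x y = pt x' y'"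
  shows "x = x'" "y = y'"
proof -
  obtain m n where mn: "x' = x + m * r - n * t" "y' = y + n * s"
    using assms(5) by (auto simp: pt_eq_iff)
  have "y' mod s = y mod s" using mn by simp
  then show y: "y = y'" using assms by simp
  then have "n = 0" using mn s_pos by simp
  then have "x' mod r = x mod r" using mn by simp
  then show "x = x'" using assms by simp
qed

lemma finite_V: "finite V"
proof -
  have "V \<subseteq> (\<lambda>(x, y). pt x y) ` ({0..<r} \<times> {0..<s})"
  proof
    fix p assume "p \<in> V"
    then obtain x y where p: "p = pt x y" by (auto simp: vertices_eq)
    obtain x' y' where "x' \<in> {0..<r}" "y' \<in> {0..<s}" "pt x y = pt x' y'"
      using fundamental_domain by blast
    then show "p \<in> (\<lambda>(x, y). pt x y) ` ({0..<r} \<times> {0..<s})"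
      unfolding p by (intro image_eqI[of _ _ "(x', y')"]) simp_all
  qed
  then show ?thesis by (rule finite_subset) auto
qed

section \<open>Passing between periodic functions and colorings of the torus\<close>

lemma descend_pt:
  assumes "periodic F"
  shows "descend F (pt x y) = F x y"
proof -
  have "(\<lambda>(x, y). F x y) ` pt x y = {F x y}"
    using periodic_iterate[OF assms] pt_mem[of x y]
    by (force simp: torus_point_def torus_rel_def)
  then show ?thesis by (simp add: descend_def)
qed

lemma descend_lift:
  assumes "f \<in> extensional V"
  shows "descend (\<lambda>x y. f (pt x y)) = f"
proof (rule extensionalityI[of _ V])
  fix p assume "p \<in> V"
  then obtain x y where "p = pt x y" by (auto simp: vertices_eq)
  then show "descend (\<lambda>x y. f (pt x y)) p = f p"
    using descend_pt[OF periodic_pt] by metis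
qed (use assms in \<open>auto simp: descend_def\<close>)

lemma edge_iff:
  "{u, v} \<in> E \<longleftrightarrow> (\<exists>x y i j. (i, j) \<in> {(1, 0), (0, 1), (1, 1)} \<and>
     (u = pt x y \<and> v = pt (x + i) (y + j) \<or> v = pt x y \<and> u = pt (x + i) (y + j)))"
proof -
  have "{u, v} \<in> E \<longleftrightarrow> (\<exists>x y i j. (i, j) \<in> {(1, 0), (0, 1), (1, 1)} \<and>
      {u, v} = {pt x y, pt (x + i) (y + j)})"
    unfolding torus_edges_def mem_Collect_eq by (intro iffI; elim exE; intro exI; elim conjE; intro conjI)
  then show ?thesis unfolding doubleton_eq_iff by (simp only: conj_commute)
qed

text \<open>Plane form of \<open>kempe_equivalent_swap\<close>. Closure is stated as an equality
  along the three edge directions, so that it can be used from either end of an edge.\<close>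

lemma kempe_swap:
  assumes F: "periodic F" and S: "periodic S" and ab: "a \<in> {1..4}" "b \<in> {1..4}" "a \<noteq> b"
    and closed: "\<And>x y i j. (i, j) \<in> {(1, 0), (0, 1), (1, 1)} \<Longrightarrow> F x y \<in> {a, b} \<Longrightarrow>
      F (x + i) (y + j) \<in> {a, b} \<Longrightarrow> S x y = S (x + i) (y + j)"
  shows "kempe F (\<lambda>x y. if S x y then transpose a b (F x y) else F x y)"
proof -
  let ?S = "{p \<in> V. descend S p}"
  let ?G = "\<lambda>x y. if S x y then transpose a b (F x y) else F x y"
  have G: "periodic ?G" using F S by (simp add: periodic_def)
  have "v \<in> ?S" if "u \<in> ?S" "v \<in> V" "descend F u \<in> {a, b}" "descend F v \<in> {a, b}" and uv: "{u, v} \<in> E" for u v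
  proof -
    obtain x y i j where ij: "(i, j) \<in> {(1, 0), (0, 1), (1, 1)}"
      and "u = pt x y \<and> v = pt (x + i) (y + j) \<or> v = pt x y \<and> u = pt (x + i) (y + j)"
      using uv unfolding edge_iff by blast
    then show ?thesis
      using that uv closed[OF ij, of x y] descend_pt[OF F] descend_pt[OF S] by (metis (lifting) mem_Collect_eq)
  qed
  then have "kempe_equivalent V E 4 (descend F)
      (\<lambda>v. if v \<in> ?S then transpose a b (descend F v) else descend F v)"
    using ab by (intro kempe_equivalent_swap[OF finite_V]) auto
  moreover have "(\<lambda>v. if v \<in> ?S then transpose a b (descend F v) else descend F v) = descend ?G"
  proof
    fix v
    show "(if v \<in> ?S then transpose a b (descend F v) else descend F v) = descend ?G v"
    proof (cases "v \<in> V")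
      case True
      then obtain x y where "v = pt x y" by (auto simp: vertices_eq)
      then show ?thesis using descend_pt[OF F] descend_pt[OF S] descend_pt[OF G] by simp
    qed (simp add: descend_def)
  qed
  ultimately show ?thesis by (simp add: kempe_def)
qed

lemma kempe_transpose:
  assumes "periodic F" "a \<in> {1..4}" "b \<in> {1..4}"
  shows "kempe F (\<lambda>x y. transpose a b (F x y))"
proof (cases "a = b")
  case False
  then show ?thesis
    using kempe_swap[OF assms(1), of "\<lambda>_ _. True" a b] assms by (simp add: periodic_def)
qed (simp add: kempe_refl)

end

section \<open>Height functions\<close>

text \<open>
  The pair \<open>(a, b)\<close> stands for the point of the triangular lattice with \<open>n\<^sub>1 = a\<close>, \<open>n\<^sub>2 = b\<close> and
  \<open>n\<^sub>3 = - a - b\<close>, and the three steps are its unit vectors with sum zero. The edges of the torus are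
  directed along \<open>(1, 0)\<close>, \<open>(0, 1)\<close> and \<open>(-1, -1)\<close>, so that every triangle is a directed cycle.
\<close>

definition step :: "int \<Rightarrow> int \<Rightarrow> bool" where
  "step p q \<longleftrightarrow> (p, q) \<in> {(0, - 1), (1, 0), (- 1, 1)}"

definition height :: "(int \<Rightarrow> int \<Rightarrow> int) \<Rightarrow> (int \<Rightarrow> int \<Rightarrow> int) \<Rightarrow> bool" where
  "height a b \<longleftrightarrow> (\<forall>x y.
     step (a (x + 1) y - a x y) (b (x + 1) y - b x y) \<and>
     step (a x (y + 1) - a x y) (b x (y + 1) - b x y) \<and>
     step (a x y - a (x + 1) (y + 1)) (b x y - b (x + 1) (y + 1)))"

text \<open>Numbers the classes of the lattice modulo 2: the parity of \<open>p\<close> is the low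
  bit and that of \<open>q\<close> the high bit of \<open>col p q - 1\<close>.\<close>

definition col :: "int \<Rightarrow> int \<Rightarrow> nat" where
  "col p q = 1 + nat (p mod 2) + 2 * nat (q mod 2)"

abbreviation colors :: "(int \<Rightarrow> int \<Rightarrow> int) \<Rightarrow> (int \<Rightarrow> int \<Rightarrow> int) \<Rightarrow> int \<Rightarrow> int \<Rightarrow> nat" where
  "colors a b \<equiv> \<lambda>x y. col (a x y) (b x y)"

lemma col_cases: "col p q =
    (if even q then if even p then 1 else 2 else if even p then 3 else 4)"
  by (auto simp: col_def even_iff_mod_2_eq_zero odd_iff_mod_2_eq_one)

lemma col_eq_iff: "col p q = col p' q' \<longleftrightarrow> even (p - p') \<and> even (q - q')"
  by (auto simp: col_cases)

lemma heightD:
  assumes "height a b"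
  shows "step (a (x + 1) y - a x y) (b (x + 1) y - b x y)"
    "step (a x (y + 1) - a x y) (b x (y + 1) - b x y)"
    "step (a x y - a (x + 1) (y + 1)) (b x y - b (x + 1) (y + 1))"
  using assms unfolding height_def by blast+

lemma height_edge:
  assumes "height a b" "(i, j) \<in> {(1, 0), (0, 1), (1, 1)}"
  shows "step (a (x + i) (y + j) - a x y) (b (x + i) (y + j) - b x y) \<or>
    step (a x y - a (x + i) (y + j)) (b x y - b (x + i) (y + j))"
  using assms(2) heightD[OF assms(1), of x y] by auto

text \<open>A cyclic shift of the three coordinates permutes the three steps. Results about the
  first coordinate thus apply to all three.\<close>

lemma height_rotate:
  assumes "height a b"
  shows "height b (\<lambda>x y. - a x y - b x y)"
proof -
  have *: "step (q - q') ((- p - q) - (- p' - q'))" if "step (p - p') (q - q')" for p p' q q'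
    using that by (auto simp: step_def)
  show ?thesis unfolding height_def using heightD[OF assms] by (blast intro: *)
qed

text \<open>Between levels \<open>k\<close> and \<open>k + 1\<close> an increment 1 of
  \<open>G\<close> exchanges the steps \<open>(1, 0)\<close> and \<open>(- 1, 1)\<close>, which is
  the reflection in a level line; an increment 0 keeps them. The step \<open>(0, - 1)\<close> stays
  within a level.\<close>

lemma height_fold:
  assumes "height a b" and G: "\<And>k. G (k + 1) - G k \<in> {0, 1}"
  shows "height (\<lambda>x y. a x y - 2 * G (a x y)) (\<lambda>x y. b x y + G (a x y))"
proof -
  have *: "step (p - 2 * G p - (p' - 2 * G p')) (q + G p - (q' + G p'))"
    if "step (p - p') (q - q')" for p p' q q'
  proof -
    have "G (p' + 1) - G p' \<in> {0, 1}" "G (p + 1) - G p \<in> {0, 1}" using G by blast+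
    moreover have "p = p' \<and> q = q' - 1 \<or> p = p' + 1 \<and> q = q' \<or> p' = p + 1 \<and> q = q' + 1"
      using that by (auto simp: step_def)
    ultimately show ?thesis unfolding step_def by auto
  qed
  show ?thesis unfolding height_def using heightD[OF assms(1)] by (blast intro: *)
qed

text \<open>All three steps \<open>(p, q)\<close> satisfy \<open>p - q = 1\<close> modulo 3.\<close>

lemma height_mod_3:
  assumes "height a b"
  shows "3 dvd a x y - b x y - (x + y) - (a 0 0 - b 0 0)"
proof (rule plane_iterate[of "\<lambda>x y. 3 dvd a x y - b x y - (x + y) - (a 0 0 - b 0 0)"])
  have *: "3 dvd p - q - 1" if "step p q" for p q :: int
    using that by (auto simp: step_def)
  have **: "3 dvd A \<longleftrightarrow> 3 dvd B" if "3 dvd B - A" for A B :: int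
    using that by presburger
  show "3 dvd a x y - b x y - (x + y) - (a 0 0 - b 0 0) \<longleftrightarrow>
      3 dvd a (x + 1) y - b (x + 1) y - (x + 1 + y) - (a 0 0 - b 0 0)" for x y
    using *[OF heightD(1)[OF assms, of x y]] by (intro **) (simp add: algebra_simps)
  show "3 dvd a x y - b x y - (x + y) - (a 0 0 - b 0 0) \<longleftrightarrow>
      3 dvd a x (y + 1) - b x (y + 1) - (x + (y + 1)) - (a 0 0 - b 0 0)" for x y
    using *[OF heightD(2)[OF assms, of x y]] by (intro **) (simp add: algebra_simps)
qed simp

subsection \<open>Every coloring has a height function\<close>

text \<open>The three steps represent the three nonzero classes modulo 2, so two different colors
  determine the step between them, whatever their order; \<open>step_a\<close> and
  \<open>step_b\<close> are its coordinates.\<close>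

definition step_a :: "nat \<Rightarrow> nat \<Rightarrow> int" where
  "step_a c c' = (if even (c + c') then 0 else if (c \<le> 2) = (c' \<le> 2) then 1 else - 1)"

definition step_b :: "nat \<Rightarrow> nat \<Rightarrow> int" where
  "step_b c c' = (if (c \<le> 2) = (c' \<le> 2) then 0 else if even (c + c') then - 1 else 1)"

lemma step_colors:
  assumes "c \<in> {1..4}" "c' \<in> {1..4}" "c \<noteq> c'"
  shows "step (step_a c c') (step_b c c')"
proof -
  have "c \<in> {1, 2, 3, 4}" "c' \<in> {1, 2, 3, 4}" using assms by auto
  then show ?thesis using assms(3) by (auto simp: step_def step_a_def step_b_def)
qed

text \<open>Three different colors have as differences all three nonzero classes modulo 2, and the
  three steps add up to zero.\<close>

lemma step_colors_triangle:
  assumes "c \<in> {1..4}" "c' \<in> {1..4}" "c'' \<in> {1..4}" "c \<noteq> c'" "c' \<noteq> c''" "c \<noteq> c''"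
  shows "step_a c c' + step_a c' c'' = - step_a c'' c" "step_b c c' + step_b c' c'' = - step_b c'' c"
proof -
  let ?C = "{1, 2, 3, 4} :: nat set"
  have "\<forall>c\<in>?C. \<forall>c'\<in>?C. \<forall>c''\<in>?C. c \<noteq> c' \<and> c' \<noteq> c'' \<and> c \<noteq> c'' \<longrightarrow>
      step_a c c' + step_a c' c'' = - step_a c'' c \<and> step_b c c' + step_b c' c'' = - step_b c'' c"
    by (simp add: step_a_def step_b_def)
  moreover have "c \<in> ?C" "c' \<in> ?C" "c'' \<in> ?C" using assms by auto
  ultimately show "step_a c c' + step_a c' c'' = - step_a c'' c"
    "step_b c c' + step_b c' c'' = - step_b c'' c"
    using assms(4-6) by blast+
qed

definition plane_coloring :: "nat \<Rightarrow> (int \<Rightarrow> int \<Rightarrow> nat) \<Rightarrow> bool" where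
  "plane_coloring q F \<longleftrightarrow> (\<forall>x y. F x y \<in> {1..q} \<and>
     F x y \<noteq> F (x + 1) y \<and> F x y \<noteq> F x (y + 1) \<and> F x y \<noteq> F (x + 1) (y + 1))"

lemma plane_coloringD:
  assumes "plane_coloring q F"
  shows "F x y \<in> {1..q}" "F x y \<noteq> F (x + 1) y" "F x y \<noteq> F x (y + 1)" "F x y \<noteq> F (x + 1) (y + 1)"
  using assms unfolding plane_coloring_def by blast+

text \<open>The steps read off from the colors sum to zero around both triangles of a unit square,
  so each coordinate has a potential.\<close>

lemma exists_height:
  assumes "plane_coloring 4 F"
  obtains a b where "height a b" "F = colors a b"
proof -
  note F = plane_coloringD[OF assms]
  have tri: "d (F x y) (F (x + 1) y) + d (F (x + 1) y) (F (x + 1) (y + 1)) = - d (F (x + 1) (y + 1)) (F x y)"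
    "d (F x y) (F x (y + 1)) + d (F x (y + 1)) (F (x + 1) (y + 1)) = - d (F (x + 1) (y + 1)) (F x y)"
    if "d = step_a \<or> d = step_b" for d x y
    using that F step_colors_triangle by (metis add.commute)+
  \<comment> \<open>Starting values with \<open>col a0 b0 = F 0 0\<close>; from there the parities
    of \<open>a\<close> and \<open>b\<close> follow the colors.\<close>
  define a0 b0 :: int where "a0 = (if even (F 0 0) then 1 else 0)"
    and "b0 = (if F 0 0 \<le> 2 then 0 else 1)"
  have curl: "d (F x y) (F (x + 1) y) + d (F (x + 1) y) (F (x + 1) (y + 1)) =
      d (F x y) (F x (y + 1)) + d (F x (y + 1)) (F (x + 1) (y + 1))"
    if "d = step_a \<or> d = step_b" for d x y
    using tri[OF that, of x y] by simp
  obtain a where a: "a 0 0 = a0" "\<And>x y. a (x + 1) y = a x y + step_a (F x y) (F (x + 1) y)"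
    "\<And>x y. a x (y + 1) = a x y + step_a (F x y) (F x (y + 1))"
    by (rule plane_potential[of "\<lambda>x y. step_a (F x y) (F (x + 1) y)"
          "\<lambda>x y. step_a (F x y) (F x (y + 1))" a0]) (use curl in auto)
  obtain b where b: "b 0 0 = b0" "\<And>x y. b (x + 1) y = b x y + step_b (F x y) (F (x + 1) y)"
    "\<And>x y. b x (y + 1) = b x y + step_b (F x y) (F x (y + 1))"
    by (rule plane_potential[of "\<lambda>x y. step_b (F x y) (F (x + 1) y)"
          "\<lambda>x y. step_b (F x y) (F x (y + 1))" b0]) (use curl in auto)
  have diag: "a x y - a (x + 1) (y + 1) = step_a (F (x + 1) (y + 1)) (F x y)"
    "b x y - b (x + 1) (y + 1) = step_b (F (x + 1) (y + 1)) (F x y)" for x y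
    using tri(1)[of step_a x y] tri(1)[of step_b x y] by (simp_all add: a b)
  have "step (a (x + 1) y - a x y) (b (x + 1) y - b x y)" for x y
    using step_colors[OF F(1) F(1) F(2)] by (simp add: a b)
  moreover have "step (a x (y + 1) - a x y) (b x (y + 1) - b x y)" for x y
    using step_colors[OF F(1) F(1) F(3)] by (simp add: a b)
  moreover have "step (a x y - a (x + 1) (y + 1)) (b x y - b (x + 1) (y + 1))" for x y
    using step_colors[OF F(1) F(1) F(4)[symmetric]] by (simp only: diag)
  ultimately have "height a b" unfolding height_def by blast
  moreover have "F x y = col (a x y) (b x y)" for x y
  proof -
    have 1: "even (a x y) = odd (F x y)" for x y
      by (rule plane_iterate[of "\<lambda>x y. even (a x y) = odd (F x y)"])
        (auto simp: a a0_def step_a_def)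
    have 2: "even (b x y) = (F x y \<le> 2)" for x y
      by (rule plane_iterate[of "\<lambda>x y. even (b x y) = (F x y \<le> 2)"])
        (auto simp: b b0_def step_b_def)
    have "F x y \<in> {1, 2, 3, 4}" using F(1)[of x y] by auto
    then show ?thesis using 1[of x y] 2[of x y] by (auto simp: col_cases)
  qed
  ultimately show ?thesis using that by blast
qed

section \<open>Folding\<close>

context torus
begin

lemma quasiD: "quasi a P Q \<Longrightarrow> a (x + r) y = a x y + P" "quasi a P Q \<Longrightarrow> a (x - t) (y + s) = a x y + Q"
  by (simp_all add: quasi_def)

lemma periodic_colors:
  assumes "quasi a Pa Qa" "quasi b Pb Qb" "even Pa" "even Qa" "even Pb" "even Qb"
  shows "periodic (colors a b)"
  using assms by (auto simp: periodic_def quasi_def col_cases)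

text \<open>A step is determined by its two parities, hence by the colors at its ends. Translating
  by a period keeps the colors, therefore the steps, and so changes the heights by constants, which
  are even.\<close>

lemma height_quasi:
  assumes "height a b" "periodic (colors a b)"
  obtains Pa Qa Pb Qb where "quasi a Pa Qa" "quasi b Pb Qb" "even Pa" "even Qa" "even Pb" "even Qb"
proof -
  have step_unique: "p = p' \<and> q = q'"
    if "step p q" "step p' q'" "even (p - p')" "even (q - q')" for p q p' q'
    using that by (auto simp: step_def)
  have par: "even (a (x + r) y - a x y)" "even (a (x - t) (y + s) - a x y)"
    "even (b (x + r) y - b x y)" "even (b (x - t) (y + s) - b x y)" for x y
    using assms(2) by (auto simp: periodic_def col_eq_iff)
  have const: "a (x + i) (y + j) - a x y = a i j - a 0 0 \<and> b (x + i) (y + j) - b x y = b i j - b 0 0"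
    if ij: "\<And>x y. even (a (x + i) (y + j) - a x y) \<and> even (b (x + i) (y + j) - b x y)" for i j x y
  proof (rule plane_iterate[of "\<lambda>x y. a (x + i) (y + j) - a x y = a i j - a 0 0 \<and>
        b (x + i) (y + j) - b x y = b i j - b 0 0"])
    fix x y
    have "a (x + i + 1) (y + j) - a (x + i) (y + j) = a (x + 1) y - a x y \<and>
        b (x + i + 1) (y + j) - b (x + i) (y + j) = b (x + 1) y - b x y"
      using ij[of x y] ij[of "x + 1" y]
      by (intro step_unique heightD[OF assms(1)]) (auto simp: add.commute add.left_commute)
    then show "(a (x + i) (y + j) - a x y = a i j - a 0 0 \<and>
        b (x + i) (y + j) - b x y = b i j - b 0 0) =
        (a (x + 1 + i) (y + j) - a (x + 1) y = a i j - a 0 0 \<and>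
        b (x + 1 + i) (y + j) - b (x + 1) y = b i j - b 0 0)"
      by (simp add: add.commute add.left_commute) linarith
    have "a (x + i) (y + j + 1) - a (x + i) (y + j) = a x (y + 1) - a x y \<and>
        b (x + i) (y + j + 1) - b (x + i) (y + j) = b x (y + 1) - b x y"
      using ij[of x y] ij[of x "y + 1"]
      by (intro step_unique heightD[OF assms(1)]) (auto simp: add.commute add.left_commute)
    then show "(a (x + i) (y + j) - a x y = a i j - a 0 0 \<and>
        b (x + i) (y + j) - b x y = b i j - b 0 0) =
        (a (x + i) (y + 1 + j) - a x (y + 1) = a i j - a 0 0 \<and>
        b (x + i) (y + 1 + j) - b x (y + 1) = b i j - b 0 0)"
      by (simp add: add.commute add.left_commute) linarith
  qed simp
  have r: "a (x + r) (y + 0) - a x y = a r 0 - a 0 0 \<and> b (x + r) (y + 0) - b x y = b r 0 - b 0 0" for x y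
    by (rule const) (use par in auto)
  have s: "a (x + - t) (y + s) - a x y = a (- t) s - a 0 0 \<and>
      b (x + - t) (y + s) - b x y = b (- t) s - b 0 0" for x y
    by (rule const) (use par in auto)
  show ?thesis
  proof (rule that)
    show "quasi a (a r 0 - a 0 0) (a (- t) s - a 0 0)" "quasi b (b r 0 - b 0 0) (b (- t) s - b 0 0)"
      using r s by (simp_all add: quasi_def algebra_simps)
  qed (use par[of 0 0] in simp_all)
qed

text \<open>
  Vertices with equal parity of \<open>a\<close> are adjacent only if their heights \<open>a\<close> agree, so flipping the
  parity of \<open>b\<close> on any set of levels of \<open>a\<close> is a sequence of Kempe changes.
\<close>

lemma kempe_fold:
  assumes h: "height a b" and qa: "quasi a Pa Qa" and qb: "quasi b Pb Qb"
    and ev: "even Pa" "even Qa" "even Pb" "even Qb"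
    and G: "\<And>k. G (k + 1) - G k \<in> {0, 1}"
    and GP: "\<And>k. G (k + Pa) = G k + gP" and GQ: "\<And>k. G (k + Qa) = G k + gQ" and "even gP" "even gQ"
  shows "kempe (colors a b) (colors (\<lambda>x y. a x y - 2 * G (a x y)) (\<lambda>x y. b x y + G (a x y)))"
proof -
  let ?S = "\<lambda>x y. odd (G (a x y))"
  \<comment> \<open>The parity of \<open>G\<close> on the levels is periodic because
    \<open>gP\<close> and \<open>gQ\<close> are even.\<close>
  have S: "periodic ?S"
    using assms by (auto simp: periodic_def quasi_def)
  have level: "a x y = a (x + i) (y + j)"
    if "(i, j) \<in> {(1, 0), (0, 1), (1, 1)}" "even (a x y - a (x + i) (y + j))" for x y i j
  proof -
    have "p = 0" if "step p q" "even p" for p q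
      using that by (auto simp: step_def)
    then show ?thesis using height_edge[OF h that(1), of x y] that(2) by fastforce
  qed
  \<comment> \<open>The fold keeps the parity of \<open>a\<close> and flips that of \<open>b\<close>
    on \<open>?S\<close>: it swaps 1 and 3 where \<open>a\<close> is even, and 2 and 4 where
    \<open>a\<close> is odd.\<close>
  let ?F1 = "\<lambda>x y. if ?S x y then transpose 1 3 (colors a b x y) else colors a b x y"
  let ?F2 = "\<lambda>x y. if ?S x y then transpose 2 4 (?F1 x y) else ?F1 x y"
  have F: "periodic (colors a b)" using periodic_colors qa qb ev by blast
  have F1: "periodic ?F1" using F S by (simp add: periodic_def)
  have "kempe (colors a b) ?F1"
  proof (rule kempe_swap[OF F S])
    fix x y i j
    assume ij: "(i, j) \<in> {(1::int, 0::int), (0, 1), (1, 1)}"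
      and "colors a b x y \<in> {1, 3}" "colors a b (x + i) (y + j) \<in> {1, 3}"
    then have "a x y = a (x + i) (y + j)"
      by (intro level[OF ij]) (auto simp: col_cases split: if_splits)
    then show "?S x y = ?S (x + i) (y + j)" by simp
  qed auto
  also have "kempe ?F1 ?F2"
  proof (rule kempe_swap[OF F1 S])
    fix x y i j
    assume ij: "(i, j) \<in> {(1::int, 0::int), (0, 1), (1, 1)}"
      and "?F1 x y \<in> {2, 4}" "?F1 (x + i) (y + j) \<in> {2, 4}"
    then have "a x y = a (x + i) (y + j)"
      by (intro level[OF ij]) (auto simp: col_cases transpose_def split: if_splits)
    then show "?S x y = ?S (x + i) (y + j)" by simp
  qed auto
  also have "?F2 = colors (\<lambda>x y. a x y - 2 * G (a x y)) (\<lambda>x y. b x y + G (a x y))"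
    by (auto simp: fun_eq_iff col_cases transpose_def)
  finally show ?thesis .
qed

text \<open>Rotating the coordinates permutes the colors by the 3-cycle 2, 3, 4, a product of two
  global transpositions. The inverse cycle gives \<open>kempe_rotate2\<close>.\<close>

lemma kempe_rotate:
  assumes "periodic (colors a b)"
  shows "kempe (colors a b) (colors b (\<lambda>x y. - a x y - b x y))"
proof -
  have "kempe (colors a b) (\<lambda>x y. transpose 2 3 (colors a b x y))"
    by (rule kempe_transpose) (use assms in auto)
  also have "kempe \<dots> (\<lambda>x y. transpose 2 4 (transpose 2 3 (colors a b x y)))"
    by (rule kempe_transpose) (use assms in \<open>auto simp: periodic_def\<close>)
  also have "\<dots> = colors b (\<lambda>x y. - a x y - b x y)"
    by (auto simp: fun_eq_iff col_cases transpose_def)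
  finally show ?thesis .
qed

lemma kempe_rotate2:
  assumes "periodic (colors a b)"
  shows "kempe (colors a b) (colors (\<lambda>x y. - a x y - b x y) a)"
proof -
  have "kempe (colors a b) (\<lambda>x y. transpose 2 4 (colors a b x y))"
    by (rule kempe_transpose) (use assms in auto)
  also have "kempe \<dots> (\<lambda>x y. transpose 2 3 (transpose 2 4 (colors a b x y)))"
    by (rule kempe_transpose) (use assms in \<open>auto simp: periodic_def\<close>)
  also have "\<dots> = colors (\<lambda>x y. - a x y - b x y) a"
    by (auto simp: fun_eq_iff col_cases transpose_def)
  finally show ?thesis .
qed

end

section \<open>Reduction to the 3-coloring\<close>

text \<open>\<open>w\<close> is a position in a strip of triangles whose vertices are numbered so
  that any three consecutive ones form a triangle. Directed edges move one forward or two
  back.\<close>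

definition strip :: "(int \<Rightarrow> int \<Rightarrow> int) \<Rightarrow> bool" where
  "strip w \<longleftrightarrow> (\<forall>x y. w (x + 1) y - w x y \<in> {1, - 2} \<and> w x (y + 1) - w x y \<in> {1, - 2} \<and>
     w x y - w (x + 1) (y + 1) \<in> {1, - 2})"

lemma stripD:
  assumes "strip w"
  shows "w (x + 1) y - w x y \<in> {1, - 2}" "w x (y + 1) - w x y \<in> {1, - 2}"
    "w x y - w (x + 1) (y + 1) \<in> {1, - 2}"
  using assms unfolding strip_def by blast+

lemma strip_mod_3:
  assumes "strip w"
  shows "3 dvd w x y - w 0 0 - (x + y)"
proof (rule plane_iterate[of "\<lambda>x y. 3 dvd w x y - w 0 0 - (x + y)"])
  show "3 dvd w x y - w 0 0 - (x + y) \<longleftrightarrow> 3 dvd w (x + 1) y - w 0 0 - (x + 1 + y)" for x y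
    using stripD(1)[OF assms, of x y] by (simp only: insert_iff empty_iff) presburger
  show "3 dvd w x y - w 0 0 - (x + y) \<longleftrightarrow> 3 dvd w x (y + 1) - w 0 0 - (x + (y + 1))" for x y
    using stripD(2)[OF assms, of x y] by (simp only: insert_iff empty_iff) presburger
qed simp

section \<open>The 3-coloring and its color permutations\<close>

definition three_coloring :: "(int \<Rightarrow> nat) \<Rightarrow> int \<Rightarrow> int \<Rightarrow> nat" where
  "three_coloring \<sigma> = (\<lambda>x y. \<sigma> ((x + y) mod 3))"

definition palette :: "(int \<Rightarrow> nat) \<Rightarrow> bool" where
  "palette \<sigma> \<longleftrightarrow> inj_on \<sigma> {0, 1, 2} \<and> \<sigma> ` {0, 1, 2} \<subseteq> {1..4}"

text \<open>These divisibilities make \<open>(x + y) mod 3\<close> invariant under both lattice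
  generators; \<open>exists_palette\<close> derives them from a 3-coloring.\<close>

locale torus3 = torus +
  assumes three_dvd: "3 dvd r" "3 dvd s - t"
begin

lemma periodic_three_coloring: "periodic (three_coloring \<sigma>)"
proof -
  have "(x + r + y) mod 3 = (x + y) mod 3" "(x - t + (y + s)) mod 3 = (x + y) mod 3" for x y
    using three_dvd by (simp_all add: mod_eq_dvd_iff algebra_simps)
  then show ?thesis by (simp add: periodic_def three_coloring_def)
qed

lemma kempe_palette:
  assumes "palette \<sigma>" "palette \<tau>"
  shows "kempe (three_coloring \<sigma>) (three_coloring \<tau>)"
proof -
  have swap: "kempe (three_coloring \<rho>) (three_coloring (\<lambda>i. transpose a b (\<rho> i)))"
    if "a \<in> {1..4}" "b \<in> {1..4}" for \<rho> a b
    using kempe_transpose[OF periodic_three_coloring that] by (simp add: three_coloring_def)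
  have pal: "palette (\<lambda>i. transpose a b (\<rho> i))" if "palette \<rho>" "a \<in> {1..4}" "b \<in> {1..4}" for \<rho> a b
  proof -
    have "transpose a b c \<in> {1..4}" if "c \<in> {1..4}" for c
      using that \<open>a \<in> {1..4}\<close> \<open>b \<in> {1..4}\<close> by (simp add: transpose_def)
    then show ?thesis
      using \<open>palette \<rho>\<close> unfolding palette_def inj_on_def image_subset_iff
      by (blast dest: transpose_eq_imp_eq)
  qed
  have mem: "\<rho> 0 \<in> {1..4}" "\<rho> 1 \<in> {1..4}" "\<rho> 2 \<in> {1..4}" if "palette \<rho>" for \<rho>
    using that by (auto simp: palette_def)
  have dist: "\<rho> 0 \<noteq> \<rho> 1" "\<rho> 0 \<noteq> \<rho> 2" "\<rho> 1 \<noteq> \<rho> 2" if "palette \<rho>" for \<rho>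
    using that by (auto simp: palette_def)
  \<comment> \<open>One transposition per color class. Injectivity ensures that the values already
    matched are not moved again.\<close>
  define \<sigma>1 where "\<sigma>1 = (\<lambda>i. transpose (\<sigma> 0) (\<tau> 0) (\<sigma> i))"
  define \<sigma>2 where "\<sigma>2 = (\<lambda>i. transpose (\<sigma>1 1) (\<tau> 1) (\<sigma>1 i))"
  define \<sigma>3 where "\<sigma>3 = (\<lambda>i. transpose (\<sigma>2 2) (\<tau> 2) (\<sigma>2 i))"
  note m = mem[OF assms(2)]
  have p1: "palette \<sigma>1" unfolding \<sigma>1_def by (intro pal assms mem m)
  have p2: "palette \<sigma>2" unfolding \<sigma>2_def by (intro pal p1 mem m)
  have "kempe (three_coloring \<sigma>) (three_coloring \<sigma>1)"
    unfolding \<sigma>1_def by (intro swap mem m assms)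
  also have "kempe \<dots> (three_coloring \<sigma>2)"
    unfolding \<sigma>2_def by (intro swap mem m p1)
  also have "kempe \<dots> (three_coloring \<sigma>3)"
    unfolding \<sigma>3_def by (intro swap mem m p2)
  also have "three_coloring \<sigma>3 = three_coloring \<tau>"
  proof -
    note d = dist[OF assms(2)]
    have 0: "\<sigma>1 0 = \<tau> 0" by (simp add: \<sigma>1_def)
    have 1: "\<sigma>2 1 = \<tau> 1" "\<sigma>2 0 = \<tau> 0"
      using d dist[OF p1] 0 by (auto simp: \<sigma>2_def transpose_def)
    have 2: "\<sigma>3 2 = \<tau> 2" "\<sigma>3 1 = \<tau> 1" "\<sigma>3 0 = \<tau> 0"
      using d dist[OF p2] 1 by (auto simp: \<sigma>3_def transpose_def)
    have "i mod 3 \<in> {0, 1, 2}" for i :: int by auto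
    then have "\<sigma>3 (i mod 3) = \<tau> (i mod 3)" for i using 2 by (metis insertE empty_iff)
    then show ?thesis by (simp add: three_coloring_def)
  qed
  finally show ?thesis .
qed

text \<open>
  In a strip the top level is an independent set whose neighbors lie one or two levels lower, so
  it can be recolored as if it were moved three levels down.
\<close>

lemma kempe_strip:
  assumes "palette \<tau>" "strip w" "periodic w" "\<And>x y. lo \<le> w x y \<and> w x y \<le> lo + 2 + int n"
  shows "kempe (\<lambda>x y. 1 + nat (w x y mod 4)) (three_coloring \<tau>)"
  using assms(2-)
proof (induction n arbitrary: w)
  case 0
  define c where "c = w 0 0 - lo"
  \<comment> \<open>With only the levels \<open>lo\<close> to \<open>lo + 2\<close> left, the
    residue of \<open>x + y\<close> modulo 3 determines the level; \<open>c\<close> is the offset at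
    the origin.\<close>
  define \<sigma> where "\<sigma> = (\<lambda>i. 1 + nat ((lo + (i + c) mod 3) mod 4))"
  have "w x y = lo + ((x + y) mod 3 + c) mod 3" for x y
  proof -
    have "lo \<le> w x y" "w x y \<le> lo + 2" "3 dvd w x y - w 0 0 - (x + y)"
      using 0(3)[of x y] strip_mod_3[OF 0(1), of x y] by simp_all
    then have "(w x y - lo) mod 3 = (x + y + c) mod 3"
      unfolding mod_eq_dvd_iff c_def by (simp add: algebra_simps)
    moreover have "(w x y - lo) mod 3 = w x y - lo"
      using \<open>lo \<le> w x y\<close> \<open>w x y \<le> lo + 2\<close> by (intro mod_pos_pos_trivial) auto
    ultimately show ?thesis by (simp add: mod_simps)
  qed
  then have "(\<lambda>x y. 1 + nat (w x y mod 4)) = three_coloring \<sigma>"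
    by (simp add: three_coloring_def \<sigma>_def fun_eq_iff)
  moreover have "palette \<sigma>"
  proof -
    have *: "\<sigma> i = \<sigma> j \<longleftrightarrow> (i + c) mod 3 = (j + c) mod 3" for i j
    proof -
      have "\<sigma> i = \<sigma> j \<longleftrightarrow> (lo + (i + c) mod 3) mod 4 = (lo + (j + c) mod 3) mod 4"
        unfolding \<sigma>_def by (simp add: nat_eq_iff)
      moreover have "u = v" if "0 \<le> u" "u < 3" "0 \<le> v" "v < 3" "(lo + u) mod 4 = (lo + v) mod 4" for u v
        using that by (simp add: mod_eq_dvd_iff) presburger
      then have "(lo + (i + c) mod 3) mod 4 = (lo + (j + c) mod 3) mod 4 \<longleftrightarrow>
          (i + c) mod 3 = (j + c) mod 3" by auto
      ultimately show ?thesis by simp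
    qed
    have "inj_on \<sigma> {0, 1, 2}"
    proof (rule inj_onI)
      fix i j :: int assume ij: "i \<in> {0, 1, 2}" "j \<in> {0, 1, 2}" "\<sigma> i = \<sigma> j"
      then have "(i + c) mod 3 = (j + c) mod 3" using * by blast
      then have "3 dvd i - j" by (simp add: mod_eq_dvd_iff)
      then show "i = j" using ij by auto
    qed
    moreover have "\<sigma> i \<in> {1..4}" for i
    proof -
      have "nat (k mod 4) < 4" for k :: int by simp
      then show ?thesis by (auto simp: \<sigma>_def Suc_le_eq numeral_eq_Suc less_Suc_eq_le)
    qed
    ultimately show ?thesis unfolding palette_def by blast
  qed
  ultimately show ?case using kempe_palette assms(1) by simp
next
  case (Suc n)
  define M where "M = lo + 3 + int n"
  define w' where "w' = (\<lambda>x y. if w x y = M then M - 3 else w x y)"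
  have le: "w x y \<le> M" for x y using Suc.prems(3)[of x y] by (simp add: M_def)
  have "strip w'"
    unfolding strip_def
  proof (intro allI)
    fix x y
    have *: "p - q \<in> {1, - 2} \<Longrightarrow> p \<le> M \<Longrightarrow> q \<le> M \<Longrightarrow>
      (if p = M then M - 3 else p) - (if q = M then M - 3 else q) \<in> {1, - 2}" for p q
      by auto
    show "w' (x + 1) y - w' x y \<in> {1, - 2} \<and> w' x (y + 1) - w' x y \<in> {1, - 2} \<and>
        w' x y - w' (x + 1) (y + 1) \<in> {1, - 2}"
      unfolding w'_def by (intro conjI * stripD[OF Suc.prems(1)] le)
  qed
  moreover have "periodic w'" using Suc.prems(2) by (simp add: w'_def periodic_def)
  moreover have "lo \<le> w' x y \<and> w' x y \<le> lo + 2 + int n" for x y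
    using Suc.prems(3)[of x y] by (auto simp: w'_def M_def)
  ultimately have IH: "kempe (\<lambda>x y. 1 + nat (w' x y mod 4)) (three_coloring \<tau>)"
    using Suc.IH by blast
  define k where "k = (\<lambda>i::int. 1 + nat (i mod 4))"
  let ?S = "\<lambda>x y. w x y = M"
  have k_eq: "k i = k j \<longleftrightarrow> i mod 4 = j mod 4" for i j by (simp add: k_def nat_eq_iff)
  have k_mem: "k i \<in> {1..4}" for i
  proof -
    have "nat (i mod 4) < 4" by simp
    then show ?thesis by (auto simp: k_def Suc_le_eq numeral_eq_Suc less_Suc_eq_le)
  qed
  \<comment> \<open>The levels \<open>M + 1\<close> and \<open>M - 3\<close> share a color.
    Neighbors of level \<open>M\<close> lie on \<open>M - 1\<close> or \<open>M - 2\<close> and have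
    neither of the two colors being swapped.\<close>
  have "kempe (\<lambda>x y. k (w x y))
      (\<lambda>x y. if ?S x y then transpose (k M) (k (M + 1)) (k (w x y)) else k (w x y))"
  proof (rule kempe_swap)
    show "periodic (\<lambda>x y. k (w x y))" "periodic ?S" using Suc.prems(2) by (simp_all add: periodic_def)
    show "k M \<noteq> k (M + 1)" unfolding k_eq by presburger
    fix x y i j
    assume ij: "(i, j) \<in> {(1::int, 0::int), (0, 1), (1, 1)}"
      and a: "k (w x y) \<in> {k M, k (M + 1)}" "k (w (x + i) (y + j)) \<in> {k M, k (M + 1)}"
    have "w (x + i) (y + j) - w x y \<in> {1, - 2} \<or> w x y - w (x + i) (y + j) \<in> {1, - 2}"
      using ij stripD[OF Suc.prems(1), of x y] by auto
    then have d: "w (x + i) (y + j) - w x y \<in> {1, - 2, - 1, 2}" by auto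
    have m: "i = M" if "k i \<in> {k M, k (M + 1)}" "i \<le> M" "M - 2 \<le> i" for i
    proof -
      have "4 dvd i - M \<or> 4 dvd i - (M + 1)"
        using that(1) by (simp add: k_eq mod_eq_dvd_iff)
      moreover have "i = M \<or> i = M - 1 \<or> i = M - 2" using that(2,3) by linarith
      ultimately show ?thesis by auto
    qed
    show "?S x y = ?S (x + i) (y + j)"
      using m[OF a(1) le] m[OF a(2) le] d le[of x y] le[of "x + i" "y + j"] by auto
  qed (use k_mem in auto)
  also have "(\<lambda>x y. if ?S x y then transpose (k M) (k (M + 1)) (k (w x y)) else k (w x y))
      = (\<lambda>x y. k (w' x y))"
  proof -
    have "k (M - 3) = k (M + 1)" unfolding k_eq by presburger
    then show ?thesis by (auto simp: fun_eq_iff w'_def)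
  qed
  also have "kempe \<dots> (three_coloring \<tau>)" using IH by (simp add: k_def)
  finally show ?case by (simp add: k_def)
qed

text \<open>Folding at every level puts the image between the levels 0 and 1 of \<open>a\<close>.
  There \<open>w\<close> numbers the vertices of the strip; being periodic, it takes finitely many
  values, so \<open>kempe_strip\<close> applies.\<close>

lemma kempe_of_period_zero:
  assumes "palette \<tau>" "height a b" "quasi a 0 0" "quasi b 0 0"
  shows "kempe (colors a b) (three_coloring \<tau>)"
proof -
  let ?a = "\<lambda>x y. a x y mod 2" and ?b = "\<lambda>x y. b x y + a x y div 2"
  define w where "w = (\<lambda>x y. ?a x y + 2 * ?b x y)"
  have G: "(k + 1) div 2 - k div 2 \<in> {0, 1}" for k :: int
    by (simp only: insert_iff empty_iff) presburger
  have a_alt: "a x y - 2 * (a x y div 2) = a x y mod 2" for x y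
    by (simp add: minus_mult_div_eq_mod)
  have h: "height ?a ?b" using height_fold[OF assms(2), of "\<lambda>k. k div 2", OF G] unfolding a_alt .
  have "kempe (colors a b) (colors ?a ?b)"
    using kempe_fold[of a b 0 0 0 0 "\<lambda>k. k div 2" 0 0, OF assms(2-4) _ _ _ _ G] unfolding a_alt by simp
  also have "colors ?a ?b = (\<lambda>x y. 1 + nat (w x y mod 4))"
  proof (intro ext)
    fix x y
    have mod_4: "(p + 2 * q) mod 4 = p + 2 * (q mod 2)" if "0 \<le> p" "p < 2" for p q :: int
    proof -
      have "p + 2 * q = p + 2 * (q mod 2) + 4 * (q div 2)"
        using mult_div_mod_eq[of 2 q] by linarith
      then have "(p + 2 * q) mod 4 = (p + 2 * (q mod 2)) mod 4" by (simp only: mod_mult_self2)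
      moreover have "p + 2 * (q mod 2) < 4" "0 \<le> p + 2 * (q mod 2)"
        using that pos_mod_bound[of 2 q] pos_mod_sign[of 2 q] by linarith+
      ultimately show ?thesis by simp
    qed
    have "w x y mod 4 = a x y mod 2 + 2 * (?b x y mod 2)"
      unfolding w_def by (rule mod_4) simp_all
    then show "colors ?a ?b x y = 1 + nat (w x y mod 4)"
      by (simp add: col_def nat_add_distrib nat_mult_distrib)
  qed
  also have "kempe \<dots> (three_coloring \<tau>)"
  proof -
    have "strip w"
      unfolding strip_def
    proof (intro allI)
      have *: "(p + 2 * q) - (p' + 2 * q') \<in> {1, - 2}" if "step (p - p') (q - q')" for p p' q q'
        using that by (auto simp: step_def)
      show "w (x + 1) y - w x y \<in> {1, - 2} \<and> w x (y + 1) - w x y \<in> {1, - 2} \<and>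
          w x y - w (x + 1) (y + 1) \<in> {1, - 2}" for x y
        unfolding w_def by (intro conjI * heightD[OF h])
    qed
    moreover have w: "periodic w" using assms by (simp add: w_def periodic_def quasi_def)
    moreover define lo hi where "lo = Min (descend w ` V)" and "hi = Max (descend w ` V)"
    have "w x y \<in> descend w ` V" for x y
      using imageI[OF pt_in_V, of "descend w" x y] by (simp only: descend_pt[OF w])
    then have bounds: "lo \<le> w x y" "w x y \<le> hi" for x y
      using finite_V by (simp_all add: lo_def hi_def)
    have "hi - lo \<le> int (nat (hi - lo))" by simp
    then have "lo \<le> w x y \<and> w x y \<le> lo + 2 + int (nat (hi - lo))" for x y
      using bounds[of x y] by linarith
    ultimately show ?thesis using w by (intro kempe_strip assms(1))
  qed
  finally show ?thesis .
qed

text \<open>Evaluate \<open>height_mod_3\<close> at the two lattice generators. Together with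
  evenness this gives the sublattice of index 12.\<close>

lemma period_mod_3:
  assumes "height a b" "quasi a Pa Qa" "quasi b Pb Qb"
  shows "3 dvd Pa - Pb" "3 dvd Qa - Qb"
proof -
  have "a r 0 = a 0 0 + Pa" "b r 0 = b 0 0 + Pb" "a (- t) s = a 0 0 + Qa" "b (- t) s = b 0 0 + Qb"
    using quasiD[OF assms(2), of 0 0] quasiD[OF assms(3), of 0 0] by simp_all
  then show "3 dvd Pa - Pb" "3 dvd Qa - Qb"
    using height_mod_3[OF assms(1), of r 0] height_mod_3[OF assms(1), of "- t" s] three_dvd
    by presburger+
qed

lemma quasi_third:
  assumes "quasi a Pa Qa" "quasi b Pb Qb"
  shows "quasi (\<lambda>x y. - a x y - b x y) (- Pa - Pb) (- Qa - Qb)"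
  using assms by (simp add: quasi_def)

text \<open>Here \<open>k - 2 * G k\<close> is the zigzag 0, 1, 2, 1 of period 4.\<close>

lemma kempe_fold_4:
  assumes "height a b" "quasi a (4 * i) (4 * j)" "quasi b Pb Qb" "even Pb" "even Qb"
  obtains a' b' where "height a' b'" "quasi a' 0 0" "quasi b' (Pb + 2 * i) (Qb + 2 * j)"
    "kempe (colors a b) (colors a' b')"
proof -
  define G :: "int \<Rightarrow> int" where "G k = k div 4 + (k + 1) div 4" for k
  have G: "G (k + 1) - G k \<in> {0, 1}" for k
    unfolding G_def by (simp only: insert_iff empty_iff) presburger
  have GP: "G (k + 4 * i) = G k + 2 * i" for k i
    by (simp add: G_def add.commute[of k] add.assoc)
  show ?thesis
  proof (rule that)
    show "height (\<lambda>x y. a x y - 2 * G (a x y)) (\<lambda>x y. b x y + G (a x y))"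
      by (rule height_fold[of _ _ G, OF assms(1) G])
    show "kempe (colors a b) (colors (\<lambda>x y. a x y - 2 * G (a x y)) (\<lambda>x y. b x y + G (a x y)))"
      by (rule kempe_fold[OF assms(1-3) _ _ _ _ G GP GP]) (use assms in auto)
  qed (use assms(2,3) GP in \<open>simp_all add: quasi_def\<close>)
qed

text \<open>
  In the coordinates \<open>(n\<^sub>1, n\<^sub>2, n\<^sub>3)\<close> a period \<open>(0, 6i, -6i)\<close> is folded along \<open>n\<^sub>2\<close> to
  \<open>(4i, -2i, -2i)\<close>, because \<open>k - 2 * G k\<close> drops by 2 whenever \<open>k\<close> grows by 6. Folding along
  \<open>n\<^sub>1\<close> then yields zero.
\<close>

lemma kempe_of_period_first_zero:
  assumes "palette \<tau>" "height a b" "quasi a 0 0" "quasi b (6 * i) (6 * j)"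
  shows "kempe (colors a b) (three_coloring \<tau>)"
proof -
  let ?c = "\<lambda>x y. - a x y - b x y"
  \<comment> \<open>Four of the six unit intervals in a period are reflected; four is even, as
    \<open>kempe_fold\<close> requires.\<close>
  define G :: "int \<Rightarrow> int" where "G k = k div 6 + (k + 1) div 6 + (k + 2) div 6 + (k + 3) div 6" for k
  have G: "G (k + 1) - G k \<in> {0, 1}" for k
    unfolding G_def by (simp only: insert_iff empty_iff) presburger
  have GP: "G (k + 6 * i) = G k + 4 * i" for k i
    by (simp add: G_def add.commute[of k] add.assoc)
  have hc: "height b ?c" by (rule height_rotate[OF assms(2)])
  have qc: "quasi ?c (- 6 * i) (- 6 * j)" using quasi_third[OF assms(3,4)] by simp
  let ?b = "\<lambda>x y. b x y - 2 * G (b x y)" and ?c' = "\<lambda>x y. ?c x y + G (b x y)"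
  let ?a = "\<lambda>x y. - ?b x y - ?c' x y"
  have h: "height ?b ?c'" by (rule height_fold[of _ _ G, OF hc G])
  have qb: "quasi ?b (- 2 * i) (- 2 * j)"
    using assms(4) GP by (simp add: quasi_def)
  have qc': "quasi ?c' (- 2 * i) (- 2 * j)"
    using assms(3,4) GP by (simp add: quasi_def)
  have qa: "quasi ?a (4 * i) (4 * j)" using quasi_third[OF qb qc'] by simp
  \<comment> \<open>Two more rotations bring the first coordinate back to the front.\<close>
  have "height (\<lambda>x y. - ?b x y - ?c' x y) (\<lambda>x y. - ?c' x y - ?a x y)"
    by (intro height_rotate h)
  then have ha: "height ?a ?b" by simp
  have "kempe (colors a b) (colors b ?c)"
    by (rule kempe_rotate, rule periodic_colors[OF assms(3,4)]) auto
  also have "kempe \<dots> (colors ?b ?c')"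
    by (rule kempe_fold[OF hc assms(4) qc _ _ _ _ G GP GP]) auto
  also have "kempe \<dots> (colors ?a ?b)"
    by (rule kempe_rotate2, rule periodic_colors[OF qb qc']) auto
  also obtain a' b' where ab: "height a' b'" "quasi a' 0 0"
    "quasi b' (- 2 * i + 2 * i) (- 2 * j + 2 * j)" and "kempe (colors ?a ?b) (colors a' b')"
    by (rule kempe_fold_4[OF ha qa qb]) auto
  note this(4)
  also have "kempe (colors a' b') (three_coloring \<tau>)"
    using ab by (intro kempe_of_period_zero assms(1)) auto
  finally show ?thesis .
qed

text \<open>Once the periods of the first coordinate are folded away, those of the second are
  divisible by 3 by \<open>period_mod_3\<close> and still even, hence by 6.\<close>

lemma kempe_of_period_first_4:
  assumes "palette \<tau>" "height a b" "quasi a Pa Qa" "quasi b Pb Qb" "even Pb" "even Qb"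
    "4 dvd Pa" "4 dvd Qa"
  shows "kempe (colors a b) (three_coloring \<tau>)"
proof -
  obtain i j where ij: "Pa = 4 * i" "Qa = 4 * j" using assms(7,8) by (auto elim!: dvdE)
  obtain a' b' where ab: "height a' b'" "quasi a' 0 0" "quasi b' (Pb + 2 * i) (Qb + 2 * j)"
    and k: "kempe (colors a b) (colors a' b')"
    by (rule kempe_fold_4[OF assms(2) assms(3)[unfolded ij] assms(4-6)])
  have "3 dvd Pb + 2 * i" "3 dvd Qb + 2 * j" using period_mod_3[OF ab(1-3)] by presburger+
  then have "6 dvd Pb + 2 * i" "6 dvd Qb + 2 * j" using assms(5,6) by presburger+
  then obtain i' j' where "Pb + 2 * i = 6 * i'" "Qb + 2 * j = 6 * j'" by (auto elim!: dvdE)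
  then have "kempe (colors a' b') (three_coloring \<tau>)"
    using ab kempe_of_period_first_zero[OF assms(1), of a' b'] by simp
  with k show ?thesis by (rule kempe_trans)
qed

text \<open>The halved periods have even determinant, so modulo 2 the vectors \<open>(p, q)\<close>
  and \<open>(p', q')\<close> are dependent: one of them or their sum vanishes. Hence one of the
  three coordinates has periods divisible by 4.\<close>

lemma kempe_of_period_det:
  assumes "palette \<tau>" "height a b" "quasi a Pa Qa" "quasi b Pb Qb"
    "even Pa" "even Qa" "even Pb" "even Qb" "8 dvd Pa * Qb - Pb * Qa"
  shows "kempe (colors a b) (three_coloring \<tau>)"
proof -
  obtain p p' q q' where pq: "Pa = 2 * p" "Pb = 2 * p'" "Qa = 2 * q" "Qb = 2 * q'"
    using assms(5-8) by (auto elim!: evenE)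
  have "4 * 2 dvd 4 * (p * q' - p' * q)" using assms(9) by (simp add: pq algebra_simps)
  then have "even (p * q' - p' * q)" by (subst (asm) dvd_mult_cancel_left) simp
  then consider "even p" "even q" | "even p'" "even q'" | "even (p + p')" "even (q + q')" by auto
  then show ?thesis
  proof cases
    case 1
    then show ?thesis by (intro kempe_of_period_first_4[OF assms(1-4)]) (auto simp: pq)
  next
    case 2
    have "kempe (colors a b) (colors b (\<lambda>x y. - a x y - b x y))"
      using assms by (intro kempe_rotate periodic_colors)
    also have "kempe \<dots> (three_coloring \<tau>)"
      using 2 by (intro kempe_of_period_first_4[OF assms(1) height_rotate[OF assms(2)] assms(4)
            quasi_third[OF assms(3,4)]]) (auto simp: pq)
    finally show ?thesis .
  next
    case 3
    let ?c = "\<lambda>x y. - a x y - b x y"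
    have "height ?c (\<lambda>x y. - b x y - ?c x y)" by (intro height_rotate assms)
    then have h: "height ?c a" by simp
    have "4 dvd - Pa - Pb" "4 dvd - Qa - Qb" using 3 unfolding pq by presburger+
    then have *: "kempe (colors ?c a) (three_coloring \<tau>)"
      using assms by (intro kempe_of_period_first_4[OF assms(1) h quasi_third[OF assms(3,4)] assms(3)])
    have "kempe (colors a b) (colors ?c a)"
      using assms by (intro kempe_rotate2 periodic_colors)
    then show ?thesis using * by (rule kempe_trans)
  qed
qed

end

section \<open>The degree as a determinant\<close>

text \<open>The contribution of one triangle to \<open>coloring_degree\<close>.\<close>

definition orient :: "nat \<Rightarrow> nat \<Rightarrow> nat \<Rightarrow> int" where
  "orient p q u = of_bool ((p, q, u) \<in> {(1, 2, 3), (2, 3, 1), (3, 1, 2)})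
     - of_bool ((p, q, u) \<in> {(1, 3, 2), (3, 2, 1), (2, 1, 3)})"

text \<open>
  On the boundary of the tetrahedron, four times the indicator of the face 123 minus the sum of
  the indicators of all four faces is the coboundary of this antisymmetric function on edges.
\<close>

definition edge_sign :: "nat \<Rightarrow> nat \<Rightarrow> int" where
  "edge_sign p q = of_bool ((p, q) \<in> {(1, 2), (2, 3), (3, 1)})
     - of_bool ((p, q) \<in> {(2, 1), (3, 2), (1, 3)})"

definition edge_area :: "int \<Rightarrow> int \<Rightarrow> int \<Rightarrow> int \<Rightarrow> int" where
  "edge_area p q p' q' = p * q' - q * p' + edge_sign (col p q) (col p' q')"

lemma orient_swap: "orient p q u = - orient p u q"
proof -
  have "(p, q, u) \<in> {(1, 2, 3), (2, 3, 1), (3, 1, 2)} \<longleftrightarrow> (p, u, q) \<in> {(1, 3, 2), (3, 2, 1), (2, 1, 3)}"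
    "(p, q, u) \<in> {(1, 3, 2), (3, 2, 1), (2, 1, 3)} \<longleftrightarrow> (p, u, q) \<in> {(1, 2, 3), (2, 3, 1), (3, 1, 2)}"
    by (simp_all only: insert_iff empty_iff prod.inject) blast+
  then show ?thesis unfolding orient_def by simp
qed

lemma edge_sign_swap: "edge_sign p q = - edge_sign q p"
proof -
  have "(p, q) \<in> {(1, 2), (2, 3), (3, 1)} \<longleftrightarrow> (q, p) \<in> {(2, 1), (3, 2), (1, 3)}"
    "(p, q) \<in> {(2, 1), (3, 2), (1, 3)} \<longleftrightarrow> (q, p) \<in> {(1, 2), (2, 3), (3, 1)}"
    by (simp_all only: insert_iff empty_iff prod.inject) blast+
  then show ?thesis unfolding edge_sign_def by simp
qed

lemma edge_area_swap: "edge_area p q p' q' = - edge_area p' q' p q"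
  using edge_sign_swap[of "col p q" "col p' q'"] by (simp add: edge_area_def algebra_simps)

text \<open>Around a triangle the cross products add up to plus or minus 1, the signed indicator of
  all four faces, and \<open>edge_sign\<close> corrects this to four times the face 123. Three steps
  with sum zero are distinct, which leaves six cases for each starting color.\<close>

lemma orient_area:
  assumes "step (p1 - p0) (q1 - q0)" "step (p2 - p1) (q2 - q1)" "step (p0 - p2) (q0 - q2)"
  shows "4 * orient (col p0 q0) (col p1 q1) (col p2 q2) =
    edge_area p0 q0 p1 q1 + edge_area p1 q1 p2 q2 + edge_area p2 q2 p0 q0"
proof -
  define d e d' e' where "d = p1 - p0" and "e = q1 - q0" and "d' = p2 - p1" and "e' = q2 - q1"
  have p: "p1 = p0 + d" "q1 = q0 + e" "p2 = p0 + (d + d')" "q2 = q0 + (e + e')"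
    by (simp_all add: d_def e_def d'_def e'_def)
  have cross: "p0 * q1 - q0 * p1 + (p1 * q2 - q1 * p2) + (p2 * q0 - q2 * p0) = d * e' - e * d'"
    unfolding p by (simp add: algebra_simps)
  have "(d, e, d', e') \<in> {(0, - 1, 1, 0), (0, - 1, - 1, 1), (1, 0, 0, - 1), (1, 0, - 1, 1),
      (- 1, 1, 0, - 1), (- 1, 1, 1, 0)}"
  proof -
    have "step d e" "step d' e'" "step (- (d + d')) (- (e + e'))"
      using assms by (simp_all add: d_def e_def d'_def e'_def)
    then show ?thesis
      unfolding step_def insert_iff empty_iff prod.inject by (elim disjE conjE FalseE) simp_all
  qed
  then have "4 * orient (col p0 q0) (col p1 q1) (col p2 q2) = d * e' - e * d' +
      edge_sign (col p0 q0) (col p1 q1) + edge_sign (col p1 q1) (col p2 q2) +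
      edge_sign (col p2 q2) (col p0 q0)"
    unfolding p by (cases "even p0"; cases "even q0")
      (elim insertE emptyE; simp add: col_cases orient_def edge_sign_def)+
  then show ?thesis using cross by (simp add: edge_area_def)
qed

section \<open>A discrete Stokes formula on the fundamental domain\<close>

lemma sum_int_telescope:
  fixes g :: "int \<Rightarrow> int"
  assumes "0 \<le> n"
  shows "(\<Sum>x\<in>{0..<n}. g (x + 1) - g x) = g n - g 0"
  using assms
proof (induction n rule: int_ge_induct)
  case (step i)
  then have "{0..<i + 1} = insert i {0..<i}" by auto
  then show ?case using step by simp
qed simp

context torus
begin

abbreviation "D \<equiv> {0..<r} \<times> {0..<s}"

text \<open>\<open>E1\<close> and \<open>E2\<close> live on horizontal and vertical edges. The sum
  telescopes to the boundary of \<open>D\<close>, where opposite sides cancel up to the differences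
  of \<open>K\<close> and \<open>L\<close>; each of these contributes \<open>d\<close>.\<close>

lemma sum_boundary:
  fixes E1 E2 K L :: "int \<Rightarrow> int \<Rightarrow> int"
  assumes E1r: "\<And>x y. E1 (x + r) y = E1 x y + (K (x + 1) y - K x y)"
    and E2r: "\<And>x y. E2 (x + r) y = E2 x y + (K x (y + 1) - K x y)"
    and E1t: "\<And>x y. E1 (x - t) (y + s) = E1 x y + (L (x + 1) y - L x y)"
    and Kt: "\<And>x y. K (x - t) (y + s) = K x y + d"
    and Lr: "\<And>x y. L (x + r) y = L x y - d"
  shows "(\<Sum>(x, y)\<in>D. E1 x y + E2 (x + 1) y - E1 x (y + 1) - E2 x y) = 2 * d"
proof -
  have "(\<Sum>(x, y)\<in>D. E1 x y + E2 (x + 1) y - E1 x (y + 1) - E2 x y) =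
      (\<Sum>(x, y)\<in>D. E2 (x + 1) y - E2 x y) - (\<Sum>(x, y)\<in>D. E1 x (y + 1) - E1 x y)"
    by (simp add: sum_subtractf[symmetric] case_prod_beta algebra_simps)
  also have "(\<Sum>(x, y)\<in>D. E2 (x + 1) y - E2 x y) = (\<Sum>y\<in>{0..<s}. E2 r y - E2 0 y)"
  proof -
    have "(\<Sum>(x, y)\<in>D. E2 (x + 1) y - E2 x y) = (\<Sum>y\<in>{0..<s}. \<Sum>x\<in>{0..<r}. E2 (x + 1) y - E2 x y)"
      unfolding sum.cartesian_product[symmetric] by (rule sum.swap)
    then show ?thesis
      using sum_int_telescope[of r "\<lambda>x. E2 x _"] r_pos by simp
  qed
  also have "\<dots> = (\<Sum>y\<in>{0..<s}. K 0 (y + 1) - K 0 y)"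
    using E2r[of 0] by simp
  also have "\<dots> = K 0 s - K 0 0"
    using s_pos by (simp add: sum_int_telescope)
  also have "(\<Sum>(x, y)\<in>D. E1 x (y + 1) - E1 x y) = (\<Sum>x\<in>{0..<r}. E1 x s - E1 x 0)"
    unfolding sum.cartesian_product[symmetric]
    using sum_int_telescope[of s "E1 _"] s_pos by simp
  also have "\<dots> = (\<Sum>x\<in>{0..<r}. E1 (x + t) 0 - E1 x 0) +
      (\<Sum>x\<in>{0..<r}. L (x + 1 + t) 0 - L (x + t) 0)"
  proof -
    have "E1 x s = E1 (x + t) 0 + (L (x + 1 + t) 0 - L (x + t) 0)" for x
      using E1t[of "x + t" 0] by (simp add: algebra_simps)
    then show ?thesis unfolding sum.distrib[symmetric] by (intro sum.cong refl) simp
  qed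
  also have "(\<Sum>x\<in>{0..<r}. L (x + 1 + t) 0 - L (x + t) 0) = - d"
    using sum_int_telescope[of r "\<lambda>x. L (x + t) 0"] r_pos Lr[of t 0] by (simp add: add.commute)
  \<comment> \<open>The top row is glued with a shift by \<open>t\<close>; its effect is computed by
    induction on \<open>t\<close>, in both directions.\<close>
  also have "(\<Sum>x\<in>{0..<r}. E1 (x + t) 0 - E1 x 0) = K t 0 - K 0 0"
  proof (rule int_iterate[of "\<lambda>t. (\<Sum>x\<in>{0..<r}. E1 (x + t) 0 - E1 x 0) = K t 0 - K 0 0"])
    fix n
    have "(\<Sum>x\<in>{0..<r}. E1 (x + 1 + n) 0 - E1 (x + n) 0) = K (n + 1) 0 - K n 0"
      using sum_int_telescope[of r "\<lambda>x. E1 (x + n) 0"] r_pos E1r[of n 0] by (simp add: add.commute)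
    moreover have "(\<Sum>x\<in>{0..<r}. E1 (x + (n + 1)) 0 - E1 x 0) =
        (\<Sum>x\<in>{0..<r}. E1 (x + n) 0 - E1 x 0) + (\<Sum>x\<in>{0..<r}. E1 (x + 1 + n) 0 - E1 (x + n) 0)"
      by (simp add: sum.distrib[symmetric] algebra_simps)
    ultimately show "(\<Sum>x\<in>{0..<r}. E1 (x + n) 0 - E1 x 0) = K n 0 - K 0 0 \<longleftrightarrow>
        (\<Sum>x\<in>{0..<r}. E1 (x + (n + 1)) 0 - E1 x 0) = K (n + 1) 0 - K 0 0"
      by linarith
  qed simp
  finally show ?thesis using Kt[of t 0] by simp
qed

section \<open>The degree as a sum over the fundamental domain\<close>

definition lower :: "int \<times> int \<Rightarrow> (int \<times> int) set \<times> (int \<times> int) set \<times> (int \<times> int) set" where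
  "lower = (\<lambda>(x, y). (pt x y, pt (x + 1) y, pt (x + 1) (y + 1)))"

definition upper :: "int \<times> int \<Rightarrow> (int \<times> int) set \<times> (int \<times> int) set \<times> (int \<times> int) set" where
  "upper = (\<lambda>(x, y). (pt x y, pt (x + 1) (y + 1), pt x (y + 1)))"

lemma pt_add_cong: "pt x y = pt x' y' \<Longrightarrow> pt (x + i) (y + j) = pt (x' + i) (y' + j)"
  unfolding pt_eq_iff by (elim exE conjE, intro exI conjI) auto

lemma triangles_eq: "torus_triangles r s t = lower ` D \<union> upper ` D"
proof -
  have "lower (x, y) \<in> lower ` D \<and> upper (x, y) \<in> upper ` D" for x y
  proof -
    obtain x' y' where d: "x' \<in> {0..<r}" "y' \<in> {0..<s}" and e: "pt x y = pt x' y'"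
      using fundamental_domain by blast
    have "lower (x, y) = lower (x', y')" "upper (x, y) = upper (x', y')"
      using pt_add_cong[OF e, of 1 0] pt_add_cong[OF e, of 1 1] pt_add_cong[OF e, of 0 1] e
      by (simp_all add: lower_def upper_def)
    then show ?thesis using d by auto
  qed
  then have "range lower \<subseteq> lower ` D" "range upper \<subseteq> upper ` D" by auto
  then have "lower ` D = range lower" "upper ` D = range upper" by blast+
  then show ?thesis by (auto simp: torus_triangles_def lower_def upper_def)
qed

lemma degree_eq_sum:
  assumes "\<And>x y. f (pt x y) = F x y" "plane_coloring 4 F"
  shows "coloring_degree r s t f = (\<Sum>(x, y)\<in>D.
    orient (F x y) (F (x + 1) y) (F (x + 1) (y + 1)) + orient (F x y) (F (x + 1) (y + 1)) (F x (y + 1)))"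
proof -
  let ?T = "torus_triangles r s t"
  let ?o = "\<lambda>(u, v, w). orient (f u) (f v) (f w)"
  have fin: "finite ?T" by (simp add: triangles_eq)
  have count: "int (card {(u, v, w) \<in> ?T. (f u, f v, f w) \<in> C}) =
      (\<Sum>\<tau>\<in>?T. of_bool (case \<tau> of (u, v, w) \<Rightarrow> (f u, f v, f w) \<in> C))" for C
  proof -
    have "{(u, v, w) \<in> ?T. (f u, f v, f w) \<in> C} =
        ?T \<inter> {\<tau>. (case \<tau> of (u, v, w) \<Rightarrow> (f u, f v, f w) \<in> C)}" by auto
    then show ?thesis by (simp add: fin)
  qed
  have "coloring_degree r s t f = (\<Sum>\<tau>\<in>?T. ?o \<tau>)"
    unfolding coloring_degree_def face_count_def count
    by (simp add: sum_subtractf[symmetric] orient_def case_prod_beta)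
  also have "\<dots> = (\<Sum>\<tau>\<in>lower ` D. ?o \<tau>) + (\<Sum>\<tau>\<in>upper ` D. ?o \<tau>)"
  proof -
    \<comment> \<open>A common triple would turn a vertical edge into a loop, which the coloring
      excludes.\<close>
    have "lower (x, y) \<noteq> upper (x', y')" for x y x' y'
    proof
      assume that: "lower (x, y) = upper (x', y')"
      have 1: "pt x y = pt x' y'" and 2: "pt (x + 1) y = pt (x' + 1) (y' + 1)"
        using that by (simp_all add: lower_def upper_def)
      then have "pt (x + 1) y = pt (x + 1) (y + 1)" using pt_add_cong[OF 1, of 1 1] by simp
      then have "F (x + 1) y = F (x + 1) (y + 1)" using assms(1) by metis
      then show False using plane_coloringD(3)[OF assms(2)] by blast
    qed
    then have "lower p \<noteq> upper p'" for p p' by (cases p; cases p') blast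
    then have "lower ` D \<inter> upper ` D = {}" by blast
    then show ?thesis unfolding triangles_eq by (intro sum.union_disjoint) auto
  qed
  also have "(\<Sum>\<tau>\<in>lower ` D. ?o \<tau>) = (\<Sum>p\<in>D. ?o (lower p))"
    by (rule sum.reindex_cong[of lower])
      (auto simp: inj_on_def lower_def dest: fundamental_domain_inj)
  also have "(\<Sum>\<tau>\<in>upper ` D. ?o \<tau>) = (\<Sum>p\<in>D. ?o (upper p))"
    by (rule sum.reindex_cong[of upper])
      (auto simp: inj_on_def upper_def dest: fundamental_domain_inj)
  finally show ?thesis
    by (simp add: sum.distrib[symmetric] lower_def upper_def case_prod_beta assms(1))
qed

text \<open>Four times the degree is a sum of \<open>edge_area\<close> around triangles. The two
  triangles of a square cancel along the diagonal, leaving the integrand of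
  \<open>sum_boundary\<close>.\<close>

lemma degree_eq_det:
  assumes "\<And>x y. f (pt x y) = colors a b x y" "plane_coloring 4 (colors a b)"
    and h: "height a b" and qa: "quasi a Pa Qa" and qb: "quasi b Pb Qb"
    and ev: "even Pa" "even Qa" "even Pb" "even Qb"
  shows "2 * coloring_degree r s t f = Pa * Qb - Pb * Qa"
proof -
  define E1 where "E1 = (\<lambda>x y. edge_area (a x y) (b x y) (a (x + 1) y) (b (x + 1) y))"
  define E2 where "E2 = (\<lambda>x y. edge_area (a x y) (b x y) (a x (y + 1)) (b x (y + 1)))"
  define K where "K = (\<lambda>x y. Pa * b x y - Pb * a x y)"
  define L where "L = (\<lambda>x y. Qa * b x y - Qb * a x y)"
  let ?A = "\<lambda>x y x' y'. edge_area (a x y) (b x y) (a x' y') (b x' y')"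
  have "4 * orient (colors a b x y) (colors a b (x + 1) y) (colors a b (x + 1) (y + 1)) =
      E1 x y + E2 (x + 1) y + ?A (x + 1) (y + 1) x y" for x y
    using orient_area[OF heightD(1)[OF h] heightD(2)[OF h] heightD(3)[OF h]]
    by (simp add: E1_def E2_def)
  moreover have "4 * orient (colors a b x y) (colors a b x (y + 1)) (colors a b (x + 1) (y + 1)) =
      E2 x y + E1 x (y + 1) + ?A (x + 1) (y + 1) x y" for x y
    using orient_area[OF heightD(2)[OF h] heightD(1)[OF h] heightD(3)[OF h]]
    by (simp add: E1_def E2_def)
  ultimately have "4 * (orient (colors a b x y) (colors a b (x + 1) y) (colors a b (x + 1) (y + 1)) +
      orient (colors a b x y) (colors a b (x + 1) (y + 1)) (colors a b x (y + 1))) =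
      E1 x y + E2 (x + 1) y - E1 x (y + 1) - E2 x y" for x y
    using orient_swap[of "colors a b x y" "colors a b (x + 1) (y + 1)" "colors a b x (y + 1)"]
    by (smt (verit))
  then have "4 * coloring_degree r s t f =
      (\<Sum>(x, y)\<in>D. E1 x y + E2 (x + 1) y - E1 x (y + 1) - E2 x y)"
    unfolding degree_eq_sum[OF assms(1,2)] sum_distrib_left
    by (intro sum.cong refl) (simp only: case_prod_beta)
  also have "\<dots> = 2 * (Pa * Qb - Pb * Qa)"
  proof (rule sum_boundary[where K = K and L = L])
    \<comment> \<open>An even translation keeps the colors and changes the cross product by the
      difference of a linear function; for the two generators these functions are \<open>K\<close>
      and \<open>L\<close>.\<close>
    have shift: "edge_area (p + c) (q + c') (p' + c) (q' + c') =
        edge_area p q p' q' + (c * q' - c' * p' - (c * q - c' * p))"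
      if "even c" "even c'" for p q p' q' c c'
    proof -
      have "col (p + c) (q + c') = col p q" for p q using that by (simp add: col_cases)
      then show ?thesis unfolding edge_area_def by (simp only:) (simp add: algebra_simps)
    qed
    have r: "a (x + r) y = a x y + Pa" "b (x + r) y = b x y + Pb"
      "a (x + r + 1) y = a (x + 1) y + Pa" "b (x + r + 1) y = b (x + 1) y + Pb" for x y
      using quasiD(1)[OF qa] quasiD(1)[OF qb] by (metis add.assoc add.commute)+
    have t: "a (x - t) (y + s) = a x y + Qa" "b (x - t) (y + s) = b x y + Qb"
      "a (x - t + 1) (y + s) = a (x + 1) y + Qa" "b (x - t + 1) (y + s) = b (x + 1) y + Qb" for x y
      using quasiD(2)[OF qa, of x y] quasiD(2)[OF qb, of x y]
        quasiD(2)[OF qa, of "x + 1" y] quasiD(2)[OF qb, of "x + 1" y]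
      by (simp_all add: algebra_simps)
    show "E1 (x + r) y = E1 x y + (K (x + 1) y - K x y)"
      "E2 (x + r) y = E2 x y + (K x (y + 1) - K x y)"
      "E1 (x - t) (y + s) = E1 x y + (L (x + 1) y - L x y)" for x y
      unfolding E1_def E2_def K_def L_def r t by (simp_all only: shift ev)
    show "K (x - t) (y + s) = K x y + (Pa * Qb - Pb * Qa)"
      "L (x + r) y = L x y - (Pa * Qb - Pb * Qa)" for x y
      unfolding K_def L_def r t by (simp_all add: algebra_simps)
  qed
  finally show ?thesis by simp
qed

section \<open>3-colorings\<close>

text \<open>In a 3-coloring the vertices opposite to a common edge of two triangles have equal
  colors. Across diagonals this makes \<open>G\<close> depend on \<open>x + y\<close> only, and
  across vertical edges it gives period 3.\<close>

lemma exists_palette: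
  assumes G: "plane_coloring 3 G" and per: "periodic G"
  obtains \<tau> where "palette \<tau>" "G = three_coloring \<tau>" "3 dvd r" "3 dvd s - t"
proof -
  note C = plane_coloringD[OF G]
  have third: "c = c'" if "c \<in> {1..3}" "c' \<in> {1..3}" "u \<in> {1..3}" "v \<in> {1..3}"
    "u \<noteq> v" "c \<noteq> u" "c \<noteq> v" "c' \<noteq> u" "c' \<noteq> v" for c c' u v :: nat
  proof -
    have "c \<in> {1, 2, 3}" "c' \<in> {1, 2, 3}" "u \<in> {1, 2, 3}" "v \<in> {1, 2, 3}" using that by auto
    then show ?thesis using that(5-9) by auto
  qed
  have diag: "G (x + 1) y = G x (y + 1)" for x y
    by (rule third[of _ _ "G x y" "G (x + 1) (y + 1)"])
      (use C(1) C(2)[of x y] C(2)[of x "y + 1"] C(3)[of x y] C(3)[of "x + 1" y] C(4)[of x y] in auto)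
  have knight: "G (x + 2) (y + 1) = G x y" for x y
    by (rule third[of _ _ "G (x + 1) y" "G (x + 1) (y + 1)"])
      (use C(1) C(2)[of x y] C(2)[of "x + 1" "y + 1"] C(3)[of "x + 1" y] C(4)[of x y]
        C(4)[of "x + 1" y] in \<open>auto simp: add.commute\<close>)
  define k where "k = (\<lambda>n. G n 0)"
  have "G (n - y) y = k n" for n y
  proof (rule int_iterate[of "\<lambda>y. G (n - y) y = k n"])
    show "(G (n - y) y = k n) = (G (n - (y + 1)) (y + 1) = k n)" for y
      using diag[of "n - y - 1" y] by (simp add: algebra_simps)
  qed (simp add: k_def)
  from this[of "_ + _"] have Gk: "G x y = k (x + y)" for x y
    by (metis add_diff_cancel_right')
  have k3: "k (n + 3) = k n" for n
    using knight[of n 0] by (simp add: Gk add.commute)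
  have "k (n + 3 * m) = k n" for n m
  proof (rule int_iterate[of "\<lambda>m. k (n + 3 * m) = k n"])
    show "(k (n + 3 * m) = k n) = (k (n + 3 * (m + 1)) = k n)" for m
      using k3[of "n + 3 * m"] by (simp add: algebra_simps)
  qed simp
  from this[of "_ mod 3" "_ div 3"] have km: "k n = k (n mod 3)" for n
    by (metis mod_mult_div_eq)
  have ne: "k 0 \<noteq> k 1" "k 0 \<noteq> k 2" "k 1 \<noteq> k 2"
    using C(2)[of 0 0] C(4)[of 0 0] C(2)[of 1 0] by (simp_all add: Gk)
  have "k n \<in> {1..4}" for n
    using C(1)[of n 0] unfolding k_def atLeastAtMost_iff by linarith
  then have "palette k" using ne by (auto simp: palette_def)
  moreover have "G = three_coloring k"
    using km by (simp add: three_coloring_def fun_eq_iff Gk)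
  moreover have zero: "3 dvd n" if "k n = k 0" for n
  proof -
    have "n mod 3 = 0 \<or> n mod 3 = 1 \<or> n mod 3 = 2" by presburger
    then show ?thesis using that km[of n] ne by auto
  qed
  have "G r 0 = G 0 0" "G (- t) s = G 0 0"
    using per unfolding periodic_def by (metis add_0 diff_0)+
  then have "3 dvd r" "3 dvd s - t" using zero by (simp_all add: Gk)
  ultimately show ?thesis using that by blast
qed

lemma lift_coloring:
  assumes "proper_coloring V E q f"
  shows "plane_coloring q (\<lambda>x y. f (pt x y))" "descend (\<lambda>x y. f (pt x y)) = f"
proof -
  have f: "f \<in> V \<rightarrow>\<^sub>E {1..q}" "\<And>u v. {u, v} \<in> E \<Longrightarrow> f u \<noteq> f v"
    using assms by (auto simp: proper_coloring_def)
  show "descend (\<lambda>x y. f (pt x y)) = f"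
    using f(1) by (intro descend_lift) (simp add: PiE_def)
  have "{pt x y, pt (x + i) (y + j)} \<in> E" if "(i, j) \<in> {(1, 0), (0, 1), (1, 1)}" for x y i j
    using that unfolding edge_iff by blast
  from this[of 1 0] this[of 0 1] this[of 1 1]
  have "{pt x y, pt (x + 1) y} \<in> E" "{pt x y, pt x (y + 1)} \<in> E"
    "{pt x y, pt (x + 1) (y + 1)} \<in> E" for x y by simp_all
  then show "plane_coloring q (\<lambda>x y. f (pt x y))"
    unfolding plane_coloring_def using f(2) PiE_mem[OF f(1) pt_in_V] by blast
qed

end

theorem theorem3p6:
  fixes r s t :: int and f g :: "(int \<times> int) set \<Rightarrow> nat"
  assumes "r > 0" and "s > 0"
    and "proper_coloring (torus_vertices r s t) (torus_edges r s t) 3 g"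
    and "proper_coloring (torus_vertices r s t) (torus_edges r s t) 4 f"
    and "12 dvd coloring_degree r s t f"
  shows "kempe_equivalent (torus_vertices r s t) (torus_edges r s t) 4 f g"
proof -
  interpret torus r s t using assms(1,2) by unfold_locales
  obtain \<tau> where \<tau>: "palette \<tau>" "(\<lambda>x y. g (pt x y)) = three_coloring \<tau>" "3 dvd r" "3 dvd s - t"
    using exists_palette[OF lift_coloring(1)[OF assms(3)] periodic_pt] by blast
  interpret torus3 r s t using \<tau>(3,4) by unfold_locales
  note F = lift_coloring(1)[OF assms(4)]
  obtain a b where ab: "height a b" "(\<lambda>x y. f (pt x y)) = colors a b"
    using exists_height[OF F] by blast
  obtain Pa Qa Pb Qb where q: "quasi a Pa Qa" "quasi b Pb Qb"
    and ev: "even Pa" "even Qa" "even Pb" "even Qb"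
    using height_quasi[OF ab(1)] periodic_pt[of f] unfolding ab(2) by blast
  have "2 * coloring_degree r s t f = Pa * Qb - Pb * Qa"
    using degree_eq_det[OF _ F[unfolded ab(2)] ab(1) q ev, of f] ab(2) by metis
  moreover have "2 * 12 dvd 2 * coloring_degree r s t f" using assms(5) by (rule mult_dvd_mono[OF dvd_refl])
  ultimately have "8 dvd Pa * Qb - Pb * Qa" by presburger
  then have "kempe (colors a b) (three_coloring \<tau>)"
    using kempe_of_period_det[OF \<tau>(1) ab(1) q ev] by blast
  then show ?thesis
    unfolding kempe_def ab(2)[symmetric] \<tau>(2)[symmetric]
    by (simp only: lift_coloring(2)[OF assms(3)] lift_coloring(2)[OF assms(4)])
qed

end
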